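(* Let $\mathbf{H}$ be a pseudovariety of groups. Then for every finite semigroup $S$, $$\mathscr{C}_{\mathbf{GH}}(S) = \mathsf{PL}_{\mathbf{GH}}(S),$$ where $\mathscr{C}_{\mathbf{GH}}(S)$ is the minimal $S$-complex closed under unioning $\mathbf{H}$-pointlike subsets of its subgroups, and $\mathsf{PL}_{\mathbf{GH}}(S)$ is the set of $\mathbf{GH}$-pointlike subsets of $S$.
   Context: All semigroups are finite. A pseudovariety is a class of finite semigroups closed under subsemigroups, quotients and finite products of its members; a pseudovariety of groups is one all of whose members are groups. For a pseudovariety of groups $\mathbf{H}$, let $\mathbf{GH}$ be the pseudovariety of all finite semigroups all of whose subgroups belong to $\mathbf{H}$ (a subgroup of a semigroup is a subsemigroup which is a group, not necessarily with the identity of an ambient monoid). For a finite semigroup $S$, $P(S)$ is the semigroup of non-empty subsets of $S$ under $X\cdot Y=\{xy : x\in X, y\in Y\}$. An $S$-complex is a subsemigroup $\mathcal{K}$ of $P(S)$ which contains all singletons $\{s\}$, $s\in S$, and such that if $X\in\mathcal{K}$ and $\varnothing\ne Y\subseteq X$ then $Y\in\mathcal{K}$. A relational morphism $\rho : S \to V$ is given (up to equality of its graph) by a subsemigroup of $S\times V$ (its graph) projecting onto $S$; for $v\in V$, $(v)\rho^{-1}$ is the set of $s\in S$ with $(s,v)$ in the graph. For a pseudovariety $\mathbf{V}$, a non-empty $X\subseteq S$ is $\mathbf{V}$-pointlike if for every relational morphism $\rho:S\to V$ with $V\in\mathbf{V}$ there is $v\in V$ with $X\subseteq (v)\rho^{-1}$.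 The set of $\mathbf{V}$-pointlike subsets of $S$ is $\mathsf{PL}_{\mathbf{V}}(S)$. $\mathscr{C}_{\mathbf{GH}}(S)$ is the intersection of all $S$-complexes $\mathcal{K}$ with the property that for every subgroup $\mathcal{G}$ of the semigroup $\mathcal{K}$ and every $\mathscr{X}\in\mathsf{PL}_{\mathbf{H}}(\mathcal{G})$, the union $\bigcup\mathscr{X}\subseteq S$ belongs to $\mathcal{K}$. *)

theory Defs
  imports "HOL-Algebra.Group"
begin

record 'a sgrp = "'a partial_object" +
  sg_mult :: "'a \<Rightarrow> 'a \<Rightarrow> 'a"  (infixl "\<odot>\<index>" 70)

text \<open>Semigroups are non-empty. This is forced by the requirement that all members of a
  pseudovariety of groups (a class closed under subsemigroups) be groups.\<close>

locale finite_semigroup =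
  fixes S :: "'a sgrp" (structure)
  assumes finite_carrier: "finite (carrier S)"
    and nonempty_carrier: "carrier S \<noteq> {}"
    and closed: "\<lbrakk>x \<in> carrier S; y \<in> carrier S\<rbrakk> \<Longrightarrow> x \<odot> y \<in> carrier S"
    and assoc: "\<lbrakk>x \<in> carrier S; y \<in> carrier S; z \<in> carrier S\<rbrakk> \<Longrightarrow> (x \<odot> y) \<odot> z = x \<odot> (y \<odot> z)"

definition is_group :: "'a sgrp \<Rightarrow> bool" where
  "is_group S \<longleftrightarrow> (\<exists>e. group \<lparr>carrier = carrier S, monoid.mult = sg_mult S, one = e\<rparr>)"

definition subsemigroup :: "'a set \<Rightarrow> 'a sgrp \<Rightarrow> bool" where
  "subsemigroup A S \<longleftrightarrow>
     A \<noteq> {} \<and> A \<subseteq> carrier S \<and> (\<forall>x\<in>A. \<forall>y\<in>A. x \<odot>\<^bsub>S\<^esub> y \<in> A)"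

definition restr :: "'a sgrp \<Rightarrow> 'a set \<Rightarrow> 'a sgrp" where
  "restr S A = S\<lparr>carrier := A\<rparr>"

text \<open>The identity of a subgroup may be any idempotent of the semigroup.\<close>

definition sg_subgroup :: "'a set \<Rightarrow> 'a sgrp \<Rightarrow> bool" where
  "sg_subgroup G S \<longleftrightarrow> subsemigroup G S \<and> is_group (restr S G)"

definition sg_hom :: "'a sgrp \<Rightarrow> 'b sgrp \<Rightarrow> ('a \<Rightarrow> 'b) set" where
  "sg_hom S T = {f \<in> carrier S \<rightarrow> carrier T.
     \<forall>x\<in>carrier S. \<forall>y\<in>carrier S. f (x \<odot>\<^bsub>S\<^esub> y) = f x \<odot>\<^bsub>T\<^esub> f y}"

definition sg_prod :: "'i set \<Rightarrow> ('i \<Rightarrow> 'a sgrp) \<Rightarrow> ('i \<Rightarrow> 'a) sgrp" where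
  "sg_prod I F = \<lparr>carrier = (\<Pi>\<^sub>E i\<in>I. carrier (F i)),
                  sg_mult = (\<lambda>x y. \<lambda>i\<in>I. x i \<odot>\<^bsub>F i\<^esub> y i)\<rparr>"

definition sg_pair :: "'a sgrp \<Rightarrow> 'b sgrp \<Rightarrow> ('a \<times> 'b) sgrp" where
  "sg_pair S T = \<lparr>carrier = carrier S \<times> carrier T,
                  sg_mult = (\<lambda>(s, t) (s', t'). (s \<odot>\<^bsub>S\<^esub> s', t \<odot>\<^bsub>T\<^esub> t'))\<rparr>"

text \<open>Every finite semigroup is isomorphic to one whose carrier is a set of natural numbers,
  so an isomorphism-closed class of finite semigroups, over all element types, is determined
  by its members of type \<^typ>\<open>nat sgrp\<close>. Quotients are taken up to isomorphism, i.e. as images of surjective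
  homomorphisms, which makes the class closed under isomorphism. The products include the
  empty one (\<open>n = 0\<close>), so a pseudovariety contains the trivial semigroups.\<close>

definition pseudovariety :: "nat sgrp set \<Rightarrow> bool" where
  "pseudovariety V \<longleftrightarrow>
     (\<forall>S\<in>V. finite_semigroup S) \<and>
     (\<forall>S\<in>V. \<forall>A. subsemigroup A S \<longrightarrow> restr S A \<in> V) \<and>
     (\<forall>S\<in>V. \<forall>T f. f \<in> sg_hom S T \<and> f ` carrier S = carrier T \<longrightarrow> T \<in> V) \<and>
     (\<forall>(n::nat) F T f. (\<forall>i<n. F i \<in> V) \<and> f \<in> sg_hom (sg_prod {..<n} F) T \<and>
        bij_betw f (carrier (sg_prod {..<n} F)) (carrier T) \<longrightarrow> T \<in> V)"

definition group_pseudovariety :: "nat sgrp set \<Rightarrow> bool" where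
  "group_pseudovariety H \<longleftrightarrow> pseudovariety H \<and> (\<forall>G\<in>H. is_group G)"

definition GH :: "nat sgrp set \<Rightarrow> nat sgrp set" where
  "GH H = {T. finite_semigroup T \<and> (\<forall>G. sg_subgroup G T \<longrightarrow> restr T G \<in> H)}"

definition power_sg :: "'a sgrp \<Rightarrow> 'a set sgrp" where
  "power_sg S = \<lparr>carrier = {X. X \<subseteq> carrier S \<and> X \<noteq> {}},
                 sg_mult = (\<lambda>X Y. {x \<odot>\<^bsub>S\<^esub> y | x y. x \<in> X \<and> y \<in> Y})\<rparr>"

definition is_complex :: "'a sgrp \<Rightarrow> 'a set set \<Rightarrow> bool" where
  "is_complex S K \<longleftrightarrow>
     subsemigroup K (power_sg S) \<and>
     (\<forall>s\<in>carrier S. {s} \<in> K) \<and>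
     (\<forall>X\<in>K. \<forall>Y. Y \<noteq> {} \<and> Y \<subseteq> X \<longrightarrow> Y \<in> K)"

definition relational_morphism :: "'a sgrp \<Rightarrow> 'b sgrp \<Rightarrow> ('a \<times> 'b) set \<Rightarrow> bool" where
  "relational_morphism S T R \<longleftrightarrow> subsemigroup R (sg_pair S T) \<and> fst ` R = carrier S"

definition PL :: "nat sgrp set \<Rightarrow> 'a sgrp \<Rightarrow> 'a set set" where
  "PL V S = {X. X \<subseteq> carrier S \<and> X \<noteq> {} \<and>
     (\<forall>T\<in>V. \<forall>R. relational_morphism S T R \<longrightarrow>
        (\<exists>v\<in>carrier T. X \<subseteq> {s. (s, v) \<in> R}))}"

definition C_GH :: "nat sgrp set \<Rightarrow> 'a sgrp \<Rightarrow> 'a set set" where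
  "C_GH H S = \<Inter>{K. is_complex S K \<and>
     (\<forall>G. sg_subgroup G (restr (power_sg S) K) \<longrightarrow>
        (\<forall>\<X>\<in>PL H (restr (power_sg S) G). \<Union>\<X> \<in> K))}"

end

theory Submission
  imports Defs
begin

text \<open>A group image of a finite semigroup lifts to a subgroup, so the pointlike sets form a complex
  with the required closure property. For the converse, it suffices to find, for every subsemigroup
  \<open>T\<close> of the power semigroup closed under unioning pointlike subsets of its subgroups and every
  \<open>X \<subseteq> T\<close>, a semigroup \<open>V\<close> all of whose subgroups lie in \<open>H\<close> and a multiplicative relation between
  elements of the power semigroup and \<open>V\<close> which covers \<open>X\<close> and whose fibres are bounded by elements
  of \<open>T\<close>. This goes by induction on \<open>|T|\<close> and \<open>|X|\<close>. If some \<open>a \<in> X\<close> generates a right ideal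
  \<open>a T\<^sup>1 \<noteq> T\<close>, cut words over \<open>X\<close> at the occurrences of \<open>a\<close>: the factors between them are words over
  \<open>X - {a}\<close>, and the blocks \<open>a u\<close>, with \<open>u\<close> replaced by a bound for its fibre, are letters in the
  smaller set \<open>a T\<^sup>1\<close>; the two relations obtained by induction are merged. Otherwise every letter
  permutes \<open>T\<close> from the left and generates, together with the others, a right group, or \<open>X\<close> is a
  singleton; then \<open>V\<close> is a group in \<open>H\<close> times a semigroup with trivial subgroups.\<close>

section \<open>Finite semigroups and their subgroups\<close>

lemma restr_simps [simp]:
  "carrier (restr V A) = A" "sg_mult (restr V A) = sg_mult V"
  "restr (restr V A) B = restr V B" "restr V (carrier V) = V"
  by (simp_all add: restr_def)

lemma finite_semigroup_restr:
  assumes "finite_semigroup V" "subsemigroup A V"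
  shows "finite_semigroup (restr V A)"
proof -
  interpret finite_semigroup V by fact
  show ?thesis
    using assms(2) finite_carrier assoc
    by unfold_locales (auto simp: subsemigroup_def subset_iff intro: finite_subset)
qed

lemma sg_subgroupE:
  assumes "sg_subgroup D V"
  obtains e where "D \<subseteq> carrier V" "e \<in> D" "\<And>x y. x \<in> D \<Longrightarrow> y \<in> D \<Longrightarrow> x \<odot>\<^bsub>V\<^esub> y \<in> D"
    "\<And>x. x \<in> D \<Longrightarrow> e \<odot>\<^bsub>V\<^esub> x = x" "\<And>x. x \<in> D \<Longrightarrow> x \<odot>\<^bsub>V\<^esub> e = x"
    "\<And>x. x \<in> D \<Longrightarrow> \<exists>y\<in>D. x \<odot>\<^bsub>V\<^esub> y = e"
proof -
  obtain e where "group \<lparr>carrier = D, monoid.mult = sg_mult V, one = e\<rparr>" (is "group ?G")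
    using assms by (auto simp: sg_subgroup_def is_group_def)
  then interpret G: group ?G .
  have "D \<subseteq> carrier V" using assms by (simp add: sg_subgroup_def subsemigroup_def)
  moreover have "\<exists>y\<in>D. x \<odot>\<^bsub>V\<^esub> y = e" if "x \<in> D" for x
    using G.r_inv[of x] G.inv_closed[of x] that by auto
  ultimately show thesis
    using that[of e] G.one_closed G.m_closed G.l_one G.r_one by simp
qed

lemma sg_subgroupI:
  assumes V: "finite_semigroup V" and D: "D \<subseteq> carrier V" "e \<in> D"
    and cl: "\<And>x y. x \<in> D \<Longrightarrow> y \<in> D \<Longrightarrow> x \<odot>\<^bsub>V\<^esub> y \<in> D"
    and one: "\<And>x. x \<in> D \<Longrightarrow> e \<odot>\<^bsub>V\<^esub> x = x" "\<And>x. x \<in> D \<Longrightarrow> x \<odot>\<^bsub>V\<^esub> e = x"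
    and inv: "\<And>x. x \<in> D \<Longrightarrow> \<exists>y\<in>D. x \<odot>\<^bsub>V\<^esub> y = e"
  shows "sg_subgroup D V"
proof -
  interpret finite_semigroup V by fact
  have as: "(x \<odot>\<^bsub>V\<^esub> y) \<odot>\<^bsub>V\<^esub> z = x \<odot>\<^bsub>V\<^esub> (y \<odot>\<^bsub>V\<^esub> z)" if "x \<in> D" "y \<in> D" "z \<in> D" for x y z
    using assoc that D by blast
  have "\<exists>y\<in>D. y \<odot>\<^bsub>V\<^esub> x = e" if x: "x \<in> D" for x
  proof -
    obtain y where y: "y \<in> D" "x \<odot>\<^bsub>V\<^esub> y = e" using inv x by blast
    obtain z where z: "z \<in> D" "y \<odot>\<^bsub>V\<^esub> z = e" using inv y by blast
    \<comment> \<open>Expanding x = x(yz) = (xy)z = z shows that the right inverse \<open>z\<close>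
      of \<open>y\<close> is \<open>x\<close> itself, so \<open>y\<close> is also a left inverse of
      \<open>x\<close>.\<close>
    have "x = z" using as[OF x y(1) z(1)] y z one x by simp
    then show ?thesis using y z by blast
  qed
  then have "group \<lparr>carrier = D, monoid.mult = sg_mult V, one = e\<rparr>"
    by (intro groupI) (use D cl one as in auto)
  then show ?thesis
    using D cl by (auto simp: sg_subgroup_def subsemigroup_def is_group_def)
qed

lemma sg_subgroup_image:
  assumes U: "finite_semigroup U" and D: "sg_subgroup D V" and f: "f \<in> sg_hom (restr V D) U"
  shows "sg_subgroup (f ` D) U"
proof -
  obtain e where e: "e \<in> D" "\<And>x y. x \<in> D \<Longrightarrow> y \<in> D \<Longrightarrow> x \<odot>\<^bsub>V\<^esub> y \<in> D"
    "\<And>x. x \<in> D \<Longrightarrow> e \<odot>\<^bsub>V\<^esub> x = x" "\<And>x. x \<in> D \<Longrightarrow> x \<odot>\<^bsub>V\<^esub> e = x"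
    "\<And>x. x \<in> D \<Longrightarrow> \<exists>y\<in>D. x \<odot>\<^bsub>V\<^esub> y = e" using sg_subgroupE[OF D] by metis
  have f': "f x \<in> carrier U" "f (x \<odot>\<^bsub>V\<^esub> y) = f x \<odot>\<^bsub>U\<^esub> f y" if "x \<in> D" "y \<in> D" for x y
    using f that by (auto simp: sg_hom_def)
  show ?thesis
  proof (rule sg_subgroupI[OF U, where e = "f e"])
    fix x assume "x \<in> f ` D"
    then obtain d where d: "d \<in> D" "x = f d" by blast
    then show "f e \<odot>\<^bsub>U\<^esub> x = x" "x \<odot>\<^bsub>U\<^esub> f e = x"
      using f'(2)[OF e(1) d(1)] f'(2)[OF d(1) e(1)] e(3,4) by simp_all
    show "\<exists>y\<in>f ` D. x \<odot>\<^bsub>U\<^esub> y = f e"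
      using d e(5)[OF d(1)] f'(2)[OF d(1)] by (metis imageI)
  next
    fix x y assume "x \<in> f ` D" "y \<in> f ` D"
    then show "x \<odot>\<^bsub>U\<^esub> y \<in> f ` D" using f'(2) e(2) by (metis (no_types, opaque_lifting) image_iff)
  qed (use f' e in auto)
qed

context finite_semigroup
begin

text \<open>Take a minimal subsemigroup \<open>B\<close> inside \<open>A\<close> and
  \<open>x\<close> in \<open>B\<close>. The translate xB is a subsemigroup of \<open>B\<close>,
  hence equals \<open>B\<close>, so xy = x for some \<open>y\<close> in \<open>B\<close>. All such
  \<open>y\<close> form a subsemigroup, hence all of \<open>B\<close>, and \<open>x\<close> is one
  of them.\<close>

lemma subsemigroup_idempotent:
  assumes "subsemigroup A S"
  obtains e where "e \<in> A" "e \<odot> e = e"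
proof -
  let ?F = "{B. subsemigroup B S \<and> B \<subseteq> A}"
  have "finite ?F"
    by (rule finite_subset[of _ "Pow (carrier S)"]) (auto simp: subsemigroup_def finite_carrier)
  moreover have "?F \<noteq> {}" using assms by blast
  ultimately obtain B where B: "subsemigroup B S" "B \<subseteq> A"
    and min: "\<And>C. subsemigroup C S \<Longrightarrow> C \<subseteq> B \<Longrightarrow> C = B"
    using finite_has_minimal[of ?F] by (smt (verit) mem_Collect_eq order_trans)
  have c: "B \<subseteq> carrier S" "\<And>x y. x \<in> B \<Longrightarrow> y \<in> B \<Longrightarrow> x \<odot> y \<in> B" "B \<noteq> {}"
    using B by (auto simp: subsemigroup_def)
  then have as: "\<And>x y z. x \<in> B \<Longrightarrow> y \<in> B \<Longrightarrow> z \<in> B \<Longrightarrow> (x \<odot> y) \<odot> z = x \<odot> (y \<odot> z)"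
    using assoc by blast
  obtain x where x: "x \<in> B" using c by blast
  have "subsemigroup ((\<odot>) x ` B) S"
    unfolding subsemigroup_def
  proof (intro conjI ballI)
    fix u v assume "u \<in> (\<odot>) x ` B" "v \<in> (\<odot>) x ` B"
    then obtain u' where "u' \<in> B" "u = x \<odot> u'" "v \<in> B" using c x by blast
    then show "u \<odot> v \<in> (\<odot>) x ` B" using c x as by auto
  qed (use c x closed in auto)
  then have "(\<odot>) x ` B = B" using c x by (intro min) auto
  then obtain y where "y \<in> B" "x \<odot> y = x" using x by force
  then have "subsemigroup {y\<in>B. x \<odot> y = x} S"
    using c x as unfolding subsemigroup_def by auto (metis as)
  then have "{y\<in>B. x \<odot> y = x} = B" by (intro min) auto
  then have "x \<odot> x = x" using x by blast
  then show thesis using that x B by blast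
qed

end

text \<open>A subsemigroup that is minimal among those mapping onto the group is a group.\<close>

lemma group_lifting:
  assumes S: "finite_semigroup S" and R: "subsemigroup R S"
    and G: "sg_subgroup G V" and f: "f \<in> sg_hom (restr S R) V" "f ` R = G"
  obtains W where "sg_subgroup W S" "W \<subseteq> R" "f ` W = G"
proof -
  interpret finite_semigroup S by fact
  let ?F = "{B. subsemigroup B S \<and> B \<subseteq> R \<and> f ` B = G}"
  have "finite ?F"
    by (rule finite_subset[of _ "Pow (carrier S)"]) (auto simp: subsemigroup_def finite_carrier)
  moreover have "?F \<noteq> {}" using assms by blast
  ultimately obtain B where B: "subsemigroup B S" "B \<subseteq> R" "f ` B = G"
    and min: "\<And>C. subsemigroup C S \<Longrightarrow> C \<subseteq> B \<Longrightarrow> f ` C = G \<Longrightarrow> C = B"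
    using finite_has_minimal[of ?F] by (smt (verit) mem_Collect_eq order_trans)
  have c: "B \<subseteq> carrier S" "\<And>x y. x \<in> B \<Longrightarrow> y \<in> B \<Longrightarrow> x \<odot>\<^bsub>S\<^esub> y \<in> B" "B \<noteq> {}"
    using B by (auto simp: subsemigroup_def)
  then have as: "\<And>x y z. x \<in> B \<Longrightarrow> y \<in> B \<Longrightarrow> z \<in> B \<Longrightarrow> (x \<odot>\<^bsub>S\<^esub> y) \<odot>\<^bsub>S\<^esub> z = x \<odot>\<^bsub>S\<^esub> (y \<odot>\<^bsub>S\<^esub> z)"
    using assoc by blast
  obtain e where e: "e \<in> G" "\<And>x y. x \<in> G \<Longrightarrow> y \<in> G \<Longrightarrow> x \<odot>\<^bsub>V\<^esub> y \<in> G"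
    "\<And>x. x \<in> G \<Longrightarrow> e \<odot>\<^bsub>V\<^esub> x = x" "\<And>x. x \<in> G \<Longrightarrow> x \<odot>\<^bsub>V\<^esub> e = x"
    "group \<lparr>carrier = G, monoid.mult = sg_mult V, one = e\<rparr>"
  proof -
    obtain e where "group \<lparr>carrier = G, monoid.mult = sg_mult V, one = e\<rparr>" (is "group ?G")
      using G by (auto simp: sg_subgroup_def is_group_def)
    then interpret G: group ?G .
    show thesis
      using that[of e] G.one_closed G.m_closed G.l_one G.r_one G.is_group by simp
  qed
  interpret G: group "\<lparr>carrier = G, monoid.mult = sg_mult V, one = e\<rparr>" by (rule e(5))
  have hom: "f (x \<odot>\<^bsub>S\<^esub> y) = f x \<odot>\<^bsub>V\<^esub> f y" if "x \<in> B" "y \<in> B" for x y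
    using f that B(2) by (auto simp: sg_hom_def)
  have fB: "f x \<in> G" if "x \<in> B" for x using that B by blast
  \<comment> \<open>Translating by \<open>f x\<close> permutes the group \<open>G\<close>, so xB
    still maps onto \<open>G\<close>, and minimality gives xB = B. With the mirror image
    \<open>Rt\<close>, an idempotent of \<open>B\<close> becomes a two-sided identity, and right
    inverses exist.\<close>
  have L: "(\<lambda>y. x \<odot>\<^bsub>S\<^esub> y) ` B = B" if x: "x \<in> B" for x
  proof (rule min)
    show "subsemigroup ((\<lambda>y. x \<odot>\<^bsub>S\<^esub> y) ` B) S"
      unfolding subsemigroup_def
    proof (intro conjI ballI)
      fix u v assume "u \<in> (\<lambda>y. x \<odot>\<^bsub>S\<^esub> y) ` B" "v \<in> (\<lambda>y. x \<odot>\<^bsub>S\<^esub> y) ` B"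
      then obtain u' where "u' \<in> B" "u = x \<odot>\<^bsub>S\<^esub> u'" "v \<in> B" using c x by blast
      then show "u \<odot>\<^bsub>S\<^esub> v \<in> (\<lambda>y. x \<odot>\<^bsub>S\<^esub> y) ` B" using c x as by auto
    qed (use c x closed in auto)
    have "\<exists>b\<in>B. g = f (x \<odot>\<^bsub>S\<^esub> b)" if "g \<in> G" for g
    proof -
      have "\<exists>h\<in>G. f x \<odot>\<^bsub>V\<^esub> h = g"
      proof -
        let ?i = "m_inv \<lparr>carrier = G, monoid.mult = sg_mult V, one = e\<rparr> (f x)"
        have "?i \<in> G" using G.inv_closed fB[OF x] by simp
        moreover have "f x \<odot>\<^bsub>V\<^esub> (?i \<odot>\<^bsub>V\<^esub> g) = g"
          using G.m_assoc[of "f x" ?i g] G.r_inv[of "f x"] calculation fB[OF x] that e(3) by simp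
        ultimately show ?thesis using e(2) that by blast
      qed
      then obtain b where "b \<in> B" "f x \<odot>\<^bsub>V\<^esub> f b = g" using B(3) by blast
      then show ?thesis using hom x by metis
    qed
    then show "f ` (\<lambda>y. x \<odot>\<^bsub>S\<^esub> y) ` B = G" using fB c x by (auto simp: image_iff)
  qed (use c x in auto)
  have Rt: "(\<lambda>y. y \<odot>\<^bsub>S\<^esub> x) ` B = B" if x: "x \<in> B" for x
  proof (rule min)
    show "subsemigroup ((\<lambda>y. y \<odot>\<^bsub>S\<^esub> x) ` B) S"
      unfolding subsemigroup_def
    proof (intro conjI ballI)
      fix u v assume "u \<in> (\<lambda>y. y \<odot>\<^bsub>S\<^esub> x) ` B" "v \<in> (\<lambda>y. y \<odot>\<^bsub>S\<^esub> x) ` B"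
      then obtain v' where "v' \<in> B" "v = v' \<odot>\<^bsub>S\<^esub> x" "u \<in> B" using c x by blast
      then show "u \<odot>\<^bsub>S\<^esub> v \<in> (\<lambda>y. y \<odot>\<^bsub>S\<^esub> x) ` B"
        using c x as by (intro image_eqI[where x = "u \<odot>\<^bsub>S\<^esub> v'"]) auto
    qed (use c x closed in auto)
    have "\<exists>b\<in>B. g = f (b \<odot>\<^bsub>S\<^esub> x)" if "g \<in> G" for g
    proof -
      have "\<exists>h\<in>G. h \<odot>\<^bsub>V\<^esub> f x = g"
      proof -
        let ?i = "m_inv \<lparr>carrier = G, monoid.mult = sg_mult V, one = e\<rparr> (f x)"
        have "?i \<in> G" using G.inv_closed fB[OF x] by simp
        moreover have "(g \<odot>\<^bsub>V\<^esub> ?i) \<odot>\<^bsub>V\<^esub> f x = g"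
          using G.m_assoc[of g ?i "f x"] G.l_inv[of "f x"] calculation fB[OF x] that e(4) by simp
        ultimately show ?thesis using e(2) that by blast
      qed
      then obtain b where "b \<in> B" "f b \<odot>\<^bsub>V\<^esub> f x = g" using B(3) by blast
      then show ?thesis using hom x by metis
    qed
    then show "f ` (\<lambda>y. y \<odot>\<^bsub>S\<^esub> x) ` B = G" using fB c x by (auto simp: image_iff)
  qed (use c x in auto)
  obtain i where i: "i \<in> B" "i \<odot>\<^bsub>S\<^esub> i = i" using subsemigroup_idempotent[OF B(1)] .
  have "sg_subgroup B S"
  proof (rule sg_subgroupI[OF S c(1) i(1) c(2)])
    fix x assume x: "x \<in> B"
    obtain y where "y \<in> B" "x = i \<odot>\<^bsub>S\<^esub> y" using L[OF i(1)] x by blast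
    then show "i \<odot>\<^bsub>S\<^esub> x = x" using as i by metis
    obtain y where "y \<in> B" "x = y \<odot>\<^bsub>S\<^esub> i" using Rt[OF i(1)] x by blast
    then show "x \<odot>\<^bsub>S\<^esub> i = x" using as i by metis
    show "\<exists>y\<in>B. x \<odot>\<^bsub>S\<^esub> y = i" using L[OF x] i(1) by (metis imageE)
  qed
  then show thesis using that B by blast
qed


section \<open>The power semigroup and saturated subsemigroups\<close>

lemma finite_semigroup_pair:
  assumes "finite_semigroup V" "finite_semigroup W"
  shows "finite_semigroup (sg_pair V W)"
proof -
  interpret V: finite_semigroup V by fact
  interpret W: finite_semigroup W by fact
  show ?thesis
    using V.finite_carrier V.nonempty_carrier W.finite_carrier W.nonempty_carrier
    by unfold_locales (auto simp: sg_pair_def V.closed W.closed V.assoc W.assoc)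
qed

lemma carrier_power [simp]: "carrier (power_sg S) = {X. X \<subseteq> carrier S \<and> X \<noteq> {}}"
  by (simp add: power_sg_def)

lemma power_mult: "X \<odot>\<^bsub>power_sg S\<^esub> Y = {x \<odot>\<^bsub>S\<^esub> y | x y. x \<in> X \<and> y \<in> Y}"
  by (simp add: power_sg_def)

lemma power_mult_mono:
  "X \<subseteq> X' \<Longrightarrow> Y \<subseteq> Y' \<Longrightarrow> X \<odot>\<^bsub>power_sg S\<^esub> Y \<subseteq> X' \<odot>\<^bsub>power_sg S\<^esub> Y'"
  by (auto simp: power_mult)

lemma power_mult_Union: "X \<odot>\<^bsub>power_sg S\<^esub> \<Union>\<Y> = (\<Union>Y\<in>\<Y>. X \<odot>\<^bsub>power_sg S\<^esub> Y)"
  by (auto simp: power_mult)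

lemma finite_semigroup_power:
  assumes "finite_semigroup S"
  shows "finite_semigroup (power_sg S)"
proof -
  interpret finite_semigroup S by fact
  show ?thesis
  proof
    show "finite (carrier (power_sg S))"
      using finite_carrier by (auto intro: finite_subset[of _ "Pow (carrier S)"])
    show "carrier (power_sg S) \<noteq> {}" using nonempty_carrier by auto
  next
    fix X Y assume "X \<in> carrier (power_sg S)" "Y \<in> carrier (power_sg S)"
    then show "X \<odot>\<^bsub>power_sg S\<^esub> Y \<in> carrier (power_sg S)"
      using closed by (auto simp: power_mult subset_iff)
  next
    fix X Y Z
    assume "X \<in> carrier (power_sg S)" "Y \<in> carrier (power_sg S)" "Z \<in> carrier (power_sg S)"
    then have as: "x \<odot>\<^bsub>S\<^esub> y \<odot>\<^bsub>S\<^esub> z = x \<odot>\<^bsub>S\<^esub> (y \<odot>\<^bsub>S\<^esub> z)" if "x \<in> X" "y \<in> Y" "z \<in> Z" for x y z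
      using that assoc unfolding carrier_power by blast
    show "X \<odot>\<^bsub>power_sg S\<^esub> Y \<odot>\<^bsub>power_sg S\<^esub> Z = X \<odot>\<^bsub>power_sg S\<^esub> (Y \<odot>\<^bsub>power_sg S\<^esub> Z)"
      unfolding power_mult using as by (auto; metis)
  qed
qed

lemma sg_subgroup_restr_iff:
  assumes "subsemigroup T V"
  shows "sg_subgroup G (restr V T) \<longleftrightarrow> G \<subseteq> T \<and> sg_subgroup G V"
proof -
  have "T \<subseteq> carrier V" using assms by (simp add: subsemigroup_def)
  then have "subsemigroup G (restr V T) \<longleftrightarrow> G \<subseteq> T \<and> subsemigroup G V"
    using order_trans[of G T "carrier V"] unfolding subsemigroup_def restr_simps by argo
  then show ?thesis unfolding sg_subgroup_def by simp
qed

section \<open>The closure condition, and the pointlike sets as a complex satisfying it\<close>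

text \<open>This is the closure condition of \<open>C_GH\<close>, but imposed on a subsemigroup of
  the power semigroup rather than on a complex. In this form it passes to the right ideals on which
  the induction runs, which need not contain the singletons or be closed under subsets.\<close>

definition saturated :: "nat sgrp set \<Rightarrow> 'a sgrp \<Rightarrow> 'a set set \<Rightarrow> bool" where
  "saturated H S T \<longleftrightarrow> subsemigroup T (power_sg S) \<and>
     (\<forall>G. G \<subseteq> T \<and> sg_subgroup G (power_sg S) \<longrightarrow>
        (\<forall>\<X>\<in>PL H (restr (power_sg S) G). \<Union>\<X> \<in> T))"

lemma pairE: "relational_morphism S V R \<Longrightarrow> (s, v) \<in> R \<Longrightarrow> s \<in> carrier S \<and> v \<in> carrier V"
  by (auto simp: relational_morphism_def subsemigroup_def sg_pair_def)

lemma relational_morphism_mult: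
  assumes "relational_morphism S V R" "(s, v) \<in> R" "(s', v') \<in> R"
  shows "(s \<odot>\<^bsub>S\<^esub> s', v \<odot>\<^bsub>V\<^esub> v') \<in> R"
proof -
  have "(s, v) \<odot>\<^bsub>sg_pair S V\<^esub> (s', v') \<in> R"
    using assms unfolding relational_morphism_def subsemigroup_def by blast
  then show ?thesis by (simp add: sg_pair_def)
qed

lemma relational_morphism_total:
  "relational_morphism S V R \<Longrightarrow> s \<in> carrier S \<Longrightarrow> \<exists>v. (s, v) \<in> R"
  by (force simp: relational_morphism_def)

text \<open>The product of a subset of the fibre over \<open>v\<close> and a subset of the fibre
  over \<open>w\<close> lies in the fibre over the product of \<open>v\<close> and
  \<open>w\<close>.\<close>

lemma is_complex_PL:
  assumes S: "finite_semigroup S"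
  shows "is_complex S (PL V S)"
proof -
  interpret finite_semigroup S by fact
  have sing: "{s} \<in> PL V S" if "s \<in> carrier S" for s
    using that relational_morphism_total pairE by (fastforce simp: PL_def)
  have "X \<odot>\<^bsub>power_sg S\<^esub> Y \<in> PL V S" if XY: "X \<in> PL V S" "Y \<in> PL V S" for X Y
  proof -
    have "\<exists>v\<in>carrier T. X \<odot>\<^bsub>power_sg S\<^esub> Y \<subseteq> {s. (s, v) \<in> R}"
      if T: "T \<in> V" and R: "relational_morphism S T R" for T R
    proof -
      obtain v where v: "X \<subseteq> {s. (s, v) \<in> R}" using XY(1) T R unfolding PL_def by blast
      obtain w where w: "Y \<subseteq> {s. (s, w) \<in> R}" using XY(2) T R unfolding PL_def by blast
      have sub: "X \<odot>\<^bsub>power_sg S\<^esub> Y \<subseteq> {s. (s, v \<odot>\<^bsub>T\<^esub> w) \<in> R}"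
        using v w by (auto simp: power_mult subset_iff intro: relational_morphism_mult[OF R])
      \<comment> \<open>Some pair of \<open>R\<close> over the product of \<open>v\<close> and
        \<open>w\<close> is required to see that this product lies in the carrier of
        \<open>T\<close>.\<close>
      have "X \<noteq> {}" "Y \<noteq> {}" using XY by (auto simp: PL_def)
      then obtain x y where "x \<in> X" "y \<in> Y" by blast
      then have "(x \<odot>\<^bsub>S\<^esub> y, v \<odot>\<^bsub>T\<^esub> w) \<in> R" using sub by (auto simp: power_mult)
      then show ?thesis using sub pairE[OF R] by blast
    qed
    moreover have "X \<odot>\<^bsub>power_sg S\<^esub> Y \<in> carrier (power_sg S)"
      using XY by (intro finite_semigroup.closed[OF finite_semigroup_power[OF S]]) (auto simp: PL_def)
    ultimately show ?thesis by (auto simp: PL_def)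
  qed
  moreover have "Y \<in> PL V S" if "X \<in> PL V S" "Y \<noteq> {}" "Y \<subseteq> X" for X Y
    using that unfolding PL_def by blast
  moreover have "PL V S \<noteq> {}" using sing nonempty_carrier by blast
  moreover have "PL V S \<subseteq> carrier (power_sg S)" by (auto simp: PL_def)
  ultimately show ?thesis unfolding is_complex_def subsemigroup_def using sing by blast
qed

text \<open>A subgroup \<open>G\<close> of pointlike sets is lifted to a group \<open>W\<close> of
  pairs in the graph of containment in fibres. The projection of \<open>W\<close> to
  \<open>T\<close> is a subgroup of \<open>T\<close>, hence in \<open>H\<close>, so \<open>W\<close>
  is a relational morphism against which an \<open>H\<close>-pointlike subset of \<open>G\<close>
  can be tested.\<close>

lemma saturated_PL_GH:
  assumes S: "finite_semigroup S"
  shows "saturated H S (PL (GH H) S)"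
proof -
  let ?P = "power_sg S"
  have "\<Union>\<X> \<in> PL (GH H) S"
    if G: "G \<subseteq> PL (GH H) S" "sg_subgroup G ?P" and X: "\<X> \<in> PL H (restr ?P G)" for G \<X>
  proof -
    have "\<exists>v\<in>carrier T. \<Union>\<X> \<subseteq> {s. (s, v) \<in> R}"
      if T: "T \<in> GH H" and R: "relational_morphism S T R" for T R
    proof -
      \<comment> \<open>A set of \<open>G\<close> is paired with every element of \<open>T\<close>
        whose fibre contains it; pointlikeness of the members of \<open>G\<close> makes the first
        projection onto.\<close>
      define R' where "R' = {(Y, v). Y \<in> G \<and> v \<in> carrier T \<and> Y \<subseteq> {s. (s, v) \<in> R}}"
      have fT: "finite_semigroup T" using T by (simp add: GH_def)
      have mult: "X \<odot>\<^bsub>?P\<^esub> Y \<in> G" if "X \<in> G" "Y \<in> G" for X Y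
        using G(2) that by (auto simp: sg_subgroup_def subsemigroup_def)
      have ex: "\<exists>v. (Y, v) \<in> R'" if "Y \<in> G" for Y
        using that G T R unfolding R'_def PL_def by blast
      have "G \<noteq> {}" "G \<subseteq> carrier ?P" using G(2) by (auto simp: sg_subgroup_def subsemigroup_def)
      have "subsemigroup R' (sg_pair ?P T)"
        unfolding subsemigroup_def
      proof (intro conjI ballI)
        show "R' \<noteq> {}" using ex \<open>G \<noteq> {}\<close> by blast
        show "R' \<subseteq> carrier (sg_pair ?P T)"
          using \<open>G \<subseteq> carrier ?P\<close> unfolding R'_def sg_pair_def by auto
        fix p q assume "p \<in> R'" "q \<in> R'"
        then obtain Y v Z w where pq: "p = (Y, v)" "q = (Z, w)" "Y \<in> G" "Z \<in> G"
          "v \<in> carrier T" "w \<in> carrier T" "\<forall>s\<in>Y. (s, v) \<in> R" "\<forall>s\<in>Z. (s, w) \<in> R"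
          unfolding R'_def by blast
        moreover have "Y \<odot>\<^bsub>?P\<^esub> Z \<subseteq> {s. (s, v \<odot>\<^bsub>T\<^esub> w) \<in> R}"
          using pq(7,8) by (auto simp: power_mult intro: relational_morphism_mult[OF R])
        ultimately show "p \<odot>\<^bsub>sg_pair ?P T\<^esub> q \<in> R'"
          using mult finite_semigroup.closed[OF fT] by (simp add: R'_def sg_pair_def)
      qed
      moreover have "fst \<in> sg_hom (restr (sg_pair ?P T) R') ?P"
        using \<open>G \<subseteq> carrier ?P\<close>
        by (auto simp: sg_hom_def sg_pair_def R'_def simp del: carrier_power)
      moreover have "fst ` R' = G"
      proof
        show "fst ` R' \<subseteq> G" by (auto simp: R'_def)
        show "G \<subseteq> fst ` R'" using ex by (metis fst_conv imageI subsetI)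
      qed
      ultimately obtain W where W: "sg_subgroup W (sg_pair ?P T)" "W \<subseteq> R'" "fst ` W = G"
        using group_lifting[OF finite_semigroup_pair[OF finite_semigroup_power[OF S] fT] _ G(2)]
        by metis
      have "snd \<in> sg_hom (restr (sg_pair ?P T) W) T"
        using W by (auto simp: sg_hom_def sg_pair_def R'_def)
      then have sub: "sg_subgroup (snd ` W) T" by (rule sg_subgroup_image[OF fT W(1)])
      then have "restr T (snd ` W) \<in> H" using T by (simp add: GH_def)
      moreover have "relational_morphism (restr ?P G) (restr T (snd ` W)) W"
      proof -
        have "subsemigroup W (sg_pair ?P T)" using W(1) by (simp add: sg_subgroup_def)
        moreover have "W \<subseteq> G \<times> snd ` W" using subset_fst_snd[of W] W(3) by simp
        ultimately show ?thesis
          using W(3) by (simp add: relational_morphism_def subsemigroup_def sg_pair_def)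
      qed
      ultimately obtain v where v: "v \<in> snd ` W" "\<X> \<subseteq> {Y. (Y, v) \<in> W}"
        using X by (force simp: PL_def)
      then have "v \<in> carrier T" "\<Union>\<X> \<subseteq> {s. (s, v) \<in> R}" using W(2) by (auto simp: R'_def)
      then show ?thesis by blast
    qed
    moreover have "\<Union>\<X> \<subseteq> carrier S" "\<Union>\<X> \<noteq> {}"
      using X G by (fastforce simp: PL_def)+
    ultimately show ?thesis by (simp add: PL_def)
  qed
  then show ?thesis
    using is_complex_PL[OF S] unfolding saturated_def is_complex_def by blast
qed


section \<open>Pseudovarieties and arbitrary element types\<close>

text \<open>A copy of \<open>V\<close> along a map injective on its carrier. It brings semigroups
  over other types to the natural numbers, where the members of \<open>H\<close> and
  \<open>GH H\<close> live.\<close>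

definition sg_transport :: "('a \<Rightarrow> 'b) \<Rightarrow> 'a sgrp \<Rightarrow> 'b sgrp" where
  "sg_transport f V = \<lparr>carrier = f ` carrier V,
     sg_mult = (\<lambda>x y. f (inv_into (carrier V) f x \<odot>\<^bsub>V\<^esub> inv_into (carrier V) f y))\<rparr>"

lemma carrier_transport [simp]: "carrier (sg_transport f V) = f ` carrier V"
  by (simp add: sg_transport_def)

lemma transport_mult [simp]:
  assumes "inj_on f (carrier V)" "x \<in> carrier V" "y \<in> carrier V"
  shows "f x \<odot>\<^bsub>sg_transport f V\<^esub> f y = f (x \<odot>\<^bsub>V\<^esub> y)"
  using assms by (simp add: sg_transport_def)

lemma transport_hom:
  assumes "inj_on f (carrier V)"
  shows "f \<in> sg_hom V (sg_transport f V)"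
  using assms by (simp add: sg_hom_def)

lemma finite_semigroup_transport:
  assumes V: "finite_semigroup V" and f: "inj_on f (carrier V)"
  shows "finite_semigroup (sg_transport f V)"
proof -
  interpret finite_semigroup V by fact
  show ?thesis
    using finite_carrier nonempty_carrier f closed assoc
    by unfold_locales auto
qed

lemma
  assumes "pseudovariety H"
  shows pseudovariety_semigroup: "Q \<in> H \<Longrightarrow> finite_semigroup Q"
    and pseudovariety_restr: "Q \<in> H \<Longrightarrow> subsemigroup A Q \<Longrightarrow> restr Q A \<in> H"
    and pseudovariety_image:
      "Q \<in> H \<Longrightarrow> f \<in> sg_hom Q T \<Longrightarrow> f ` carrier Q = carrier T \<Longrightarrow> T \<in> H"
    and pseudovariety_prod: "\<forall>i<n::nat. F i \<in> H \<Longrightarrow> g \<in> sg_hom (sg_prod {..<n} F) T \<Longrightarrow>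
      bij_betw g (carrier (sg_prod {..<n} F)) (carrier T) \<Longrightarrow> T \<in> H"
proof -
  note H = assms[unfolded pseudovariety_def]
  show "Q \<in> H \<Longrightarrow> finite_semigroup Q"
    by (rule H[THEN conjunct1, THEN bspec])
  show "Q \<in> H \<Longrightarrow> subsemigroup A Q \<Longrightarrow> restr Q A \<in> H"
    by (rule H[THEN conjunct2, THEN conjunct1, THEN bspec, THEN spec, THEN mp])
  show "Q \<in> H \<Longrightarrow> f \<in> sg_hom Q T \<Longrightarrow> f ` carrier Q = carrier T \<Longrightarrow> T \<in> H"
    by (rule H[THEN conjunct2, THEN conjunct2, THEN conjunct1, THEN bspec, THEN spec, THEN spec,
          THEN mp, OF _ conjI])
  show "\<forall>i<n. F i \<in> H \<Longrightarrow> g \<in> sg_hom (sg_prod {..<n} F) T \<Longrightarrow>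
      bij_betw g (carrier (sg_prod {..<n} F)) (carrier T) \<Longrightarrow> T \<in> H"
    by (rule H[THEN conjunct2, THEN conjunct2, THEN conjunct2, THEN spec[of _ n], THEN spec[of _ F],
          THEN spec, THEN spec[of _ g], THEN mp, OF conjI[OF _ conjI]])
qed

lemma pseudovariety_embed:
  assumes H: "pseudovariety H" and Q: "Q \<in> H" and V: "finite_semigroup V"
    and f: "f \<in> sg_hom V Q" "inj_on f (carrier V)"
  shows "V \<in> H"
proof -
  interpret finite_semigroup V by fact
  let ?A = "f ` carrier V" and ?g = "inv_into (carrier V) f"
  have hom: "f x \<in> carrier Q" "f x \<odot>\<^bsub>Q\<^esub> f y = f (x \<odot>\<^bsub>V\<^esub> y)"
    if "x \<in> carrier V" "y \<in> carrier V" for x y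
    using f(1) that by (auto simp: sg_hom_def)
  have "subsemigroup ?A Q"
    unfolding subsemigroup_def
  proof (intro conjI ballI)
    fix x y assume "x \<in> ?A" "y \<in> ?A"
    then obtain u v where "x = f u" "y = f v" "u \<in> carrier V" "v \<in> carrier V" by blast
    then show "x \<odot>\<^bsub>Q\<^esub> y \<in> ?A" using hom(2) closed by simp
  qed (use nonempty_carrier hom(1) in auto)
  then have A: "restr Q ?A \<in> H" by (rule pseudovariety_restr[OF H Q])
  have "?g (f x \<odot>\<^bsub>Q\<^esub> f y) = x \<odot>\<^bsub>V\<^esub> y" if "x \<in> carrier V" "y \<in> carrier V" for x y
    using hom(2)[OF that] closed[OF that] f(2) by simp
  then have "?g \<in> sg_hom (restr Q ?A) V" "?g ` carrier (restr Q ?A) = carrier V"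
    using f(2) by (auto simp: sg_hom_def)
  then show ?thesis by (rule pseudovariety_image[OF H A])
qed

section \<open>Membership in GH independent of the element type\<close>

text \<open>The type of \<open>GH H\<close> only admits semigroups of natural numbers. This version
  is for the semigroups constructed below on sums, pairs and functions.\<close>

definition subgroups_embed :: "nat sgrp set \<Rightarrow> 'v sgrp \<Rightarrow> bool" where
  "subgroups_embed H V \<longleftrightarrow> finite_semigroup V \<and>
     (\<forall>D. sg_subgroup D V \<longrightarrow> (\<exists>Q\<in>H. \<exists>f\<in>sg_hom (restr V D) Q. inj_on f D))"

text \<open>The image of a subgroup in a member of \<open>GH H\<close> is a subgroup there and so
  belongs to \<open>H\<close>; hence an embedding into a member of \<open>GH H\<close> is as good as
  one into a member of \<open>H\<close>.\<close>

lemma subgroups_embedI: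
  assumes "finite_semigroup V"
    and "\<And>D. sg_subgroup D V \<Longrightarrow> \<exists>U\<in>GH H. \<exists>f\<in>sg_hom (restr V D) U. inj_on f D"
  shows "subgroups_embed H V"
proof -
  have "\<exists>Q\<in>H. \<exists>f\<in>sg_hom (restr V D) Q. inj_on f D" if D: "sg_subgroup D V" for D
  proof -
    obtain U f where U: "U \<in> GH H" "f \<in> sg_hom (restr V D) U" "inj_on f D"
      using assms(2) D by blast
    then have "sg_subgroup (f ` D) U" by (intro sg_subgroup_image[OF _ D]) (auto simp: GH_def)
    then have "restr U (f ` D) \<in> H" using U(1) by (simp add: GH_def)
    moreover have "f \<in> sg_hom (restr V D) (restr U (f ` D))"
      using U(2) by (auto simp: sg_hom_def)
    ultimately show ?thesis using U(3) by blast
  qed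
  then show ?thesis using assms(1) by (simp add: subgroups_embed_def)
qed

lemma H_subset_GH: "pseudovariety H \<Longrightarrow> H \<subseteq> GH H"
  by (auto simp: GH_def sg_subgroup_def intro: pseudovariety_semigroup pseudovariety_restr)

text \<open>A subgroup of the copy is carried back to \<open>V\<close> by the inverse of
  \<open>f\<close> and from there embedded into a member of \<open>H\<close>.\<close>

lemma transport_GH:
  assumes H: "pseudovariety H" and V: "subgroups_embed H V" and f: "inj_on f (carrier V)"
  shows "sg_transport f V \<in> GH H"
proof -
  let ?W = "sg_transport f V" and ?g = "inv_into (carrier V) f"
  have fV: "finite_semigroup V" using V by (simp add: subgroups_embed_def)
  interpret finite_semigroup V by fact
  have fW: "finite_semigroup ?W" using finite_semigroup_transport[OF fV f] .
  have "restr ?W D \<in> H" if D: "sg_subgroup D ?W" for D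
  proof -
    have sub: "subsemigroup D ?W" using D by (simp add: sg_subgroup_def)
    have g: "?g \<in> sg_hom (restr ?W D) V"
    proof -
      have "?g (x \<odot>\<^bsub>?W\<^esub> y) = ?g x \<odot>\<^bsub>V\<^esub> ?g y" if "x \<in> f ` carrier V" "y \<in> f ` carrier V" for x y
        using that f closed by auto
      moreover have "D \<subseteq> f ` carrier V" using sub by (simp add: subsemigroup_def)
      ultimately show ?thesis by (auto simp: sg_hom_def subset_iff inv_into_into)
    qed
    then obtain Q h where Q: "Q \<in> H" "h \<in> sg_hom (restr V (?g ` D)) Q" "inj_on h (?g ` D)"
      using V sg_subgroup_image[OF fV D] by (meson subgroups_embed_def)
    have "h \<circ> ?g \<in> sg_hom (restr ?W D) Q"
      using g Q(2) by (auto simp: sg_hom_def)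
    moreover have "inj_on ?g D"
      using sub by (auto simp: subsemigroup_def intro: inj_on_subset[OF inj_on_inv_into])
    then have "inj_on (h \<circ> ?g) D" using Q(3) by (rule comp_inj_on)
    ultimately show ?thesis
      using pseudovariety_embed[OF H Q(1) finite_semigroup_restr[OF fW sub]] by simp
  qed
  then show ?thesis using fW by (simp add: GH_def)
qed

text \<open>Finitely many non-pointlike sets are refuted simultaneously by a product.\<close>

lemma fibres_pointlike:
  fixes G :: "'g sgrp"
  assumes H: "pseudovariety H" and G: "finite_semigroup G"
  obtains Q R where "Q \<in> H" "relational_morphism G Q R"
    "\<And>v. {g. (g, v) \<in> R} \<noteq> {} \<Longrightarrow> {g. (g, v) \<in> R} \<in> PL H G"
proof -
  interpret finite_semigroup G by fact
  \<comment> \<open>These are the finitely many sets to be refuted; \<open>Y\<close> enumerates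
    them, and \<open>R i\<close> with values in \<open>F i\<close> refutes
    \<open>Y i\<close>.\<close>
  define N where "N = {Y. Y \<subseteq> carrier G \<and> Y \<noteq> {} \<and> Y \<notin> PL H G}"
  have "N \<subseteq> Pow (carrier G)" unfolding N_def by blast
  then have "finite N" using finite_carrier finite_subset by blast
  then obtain Y n where Y: "bij_betw Y {0..<n::nat} N"
    using ex_bij_betw_nat_finite by blast
  have "\<exists>F R. F \<in> H \<and> relational_morphism G F R \<and> (\<forall>v\<in>carrier F. \<not> Y i \<subseteq> {s. (s, v) \<in> R})"
    if "i < n" for i
  proof -
    have "Y i \<in> N" using bij_betwE[OF Y] that by simp
    then have "Y i \<subseteq> carrier G" "Y i \<noteq> {}" "Y i \<notin> PL H G" by (simp_all add: N_def)
    then show ?thesis by (simp add: PL_def) blast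
  qed
  then obtain F R where F: "\<And>i. i < n \<Longrightarrow> F i \<in> H"
    and R: "\<And>i. i < n \<Longrightarrow> relational_morphism G (F i) (R i)"
    and Yn: "\<And>i v. i < n \<Longrightarrow> v \<in> carrier (F i) \<Longrightarrow> \<not> Y i \<subseteq> {s. (s, v) \<in> R i}"
    by metis
  have fF: "finite_semigroup (F i)" if "i < n" for i
    using pseudovariety_semigroup[OF H F[OF that]] .
  let ?P = "sg_prod {..<n} F"
  have mult: "x \<odot>\<^bsub>?P\<^esub> y = (\<lambda>i\<in>{..<n}. x i \<odot>\<^bsub>F i\<^esub> y i)" for x y by (simp add: sg_prod_def)
  have carr: "carrier ?P = (\<Pi>\<^sub>E i\<in>{..<n}. carrier (F i))" by (simp add: sg_prod_def)
  have "finite (carrier ?P)"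
    unfolding carr using finite_semigroup.finite_carrier[OF fF] by (auto intro: finite_PiE)
  \<comment> \<open>The elements of the product are functions, so they are encoded as natural
    numbers to obtain a member of \<open>H\<close>.\<close>
  then obtain h :: "_ \<Rightarrow> nat" where h: "inj_on h (carrier ?P)"
    using finite_imp_inj_to_nat_seg by metis
  let ?T = "sg_transport h ?P"
  have T: "?T \<in> H"
    using F transport_hom[OF h] h by (intro pseudovariety_prod[OF H]) (auto simp: bij_betw_def)
  define RR where "RR = {(g, h x) | g x. g \<in> carrier G \<and> x \<in> carrier ?P \<and> (\<forall>i<n. (g, x i) \<in> R i)}"
  have closedP: "x \<odot>\<^bsub>?P\<^esub> y \<in> carrier ?P" if "x \<in> carrier ?P" "y \<in> carrier ?P" for x y
    using that finite_semigroup.closed[OF fF] by (auto simp: mult carr PiE_iff)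
  have ex: "\<exists>v. (g, v) \<in> RR" if g: "g \<in> carrier G" for g
  proof -
    have "\<exists>v. (g, v) \<in> R i" if "i < n" for i using relational_morphism_total[OF R[OF that] g] .
    then obtain x where x: "\<And>i. i < n \<Longrightarrow> (g, x i) \<in> R i" by metis
    then have "restrict x {..<n} \<in> carrier ?P" using pairE[OF R] by (auto simp: carr)
    then have "(g, h (restrict x {..<n})) \<in> RR" using x g unfolding RR_def by fastforce
    then show ?thesis by blast
  qed
  have "relational_morphism G ?T RR"
    unfolding relational_morphism_def subsemigroup_def
  proof (intro conjI ballI)
    show "RR \<noteq> {}" using ex nonempty_carrier by blast
    show "RR \<subseteq> carrier (sg_pair G ?T)" by (auto simp: RR_def sg_pair_def)
    show "fst ` RR = carrier G"
    proof
      show "fst ` RR \<subseteq> carrier G" by (auto simp: RR_def)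
      show "carrier G \<subseteq> fst ` RR" using ex by (metis fst_conv imageI subsetI)
    qed
    fix p q assume "p \<in> RR" "q \<in> RR"
    then obtain g x g' x' where *: "p = (g, h x)" "q = (g', h x')" "g \<in> carrier G" "g' \<in> carrier G"
      "x \<in> carrier ?P" "x' \<in> carrier ?P" "\<forall>i<n. (g, x i) \<in> R i" "\<forall>i<n. (g', x' i) \<in> R i"
      unfolding RR_def by blast
    have "p \<odot>\<^bsub>sg_pair G ?T\<^esub> q = (g \<odot>\<^bsub>G\<^esub> g', h (x \<odot>\<^bsub>?P\<^esub> x'))"
      using * h by (simp add: sg_pair_def)
    moreover have "\<forall>i<n. (g \<odot>\<^bsub>G\<^esub> g', (x \<odot>\<^bsub>?P\<^esub> x') i) \<in> R i"
      using *(7,8) relational_morphism_mult[OF R] by (simp add: mult)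
    ultimately show "p \<odot>\<^bsub>sg_pair G ?T\<^esub> q \<in> RR"
      using closed[OF *(3,4)] closedP[OF *(5,6)] unfolding RR_def by blast
  qed
  moreover have "{g. (g, v) \<in> RR} \<in> PL H G" if ne: "{g. (g, v) \<in> RR} \<noteq> {}" for v
  proof (rule ccontr)
    assume "{g. (g, v) \<in> RR} \<notin> PL H G"
    moreover have "{g. (g, v) \<in> RR} \<subseteq> carrier G" unfolding RR_def by blast
    ultimately have "{g. (g, v) \<in> RR} \<in> N" using ne unfolding N_def by blast
    then have "{g. (g, v) \<in> RR} \<in> Y ` {0..<n}" using Y by (simp add: bij_betw_def)
    then obtain i where i: "i < n" "Y i = {g. (g, v) \<in> RR}" by force
    obtain x where x: "x \<in> carrier ?P" "v = h x" using ne by (auto simp: RR_def)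
    \<comment> \<open>The fibre of the product relation over \<open>h x\<close> is contained in the
      fibre of each factor relation \<open>R i\<close> over \<open>x i\<close>.\<close>
    have "Y i \<subseteq> {s. (s, x i) \<in> R i}"
      using i h x by (auto simp: RR_def inj_on_eq_iff)
    moreover have "x i \<in> carrier (F i)" using x i by (auto simp: carr)
    ultimately show False using Yn i by blast
  qed
  ultimately show thesis using that T by blast
qed

section \<open>Bounding relations\<close>

text \<open>A relational morphism whose domain is only asked to contain \<open>X\<close>; being
  closed under products, the domain contains everything \<open>X\<close> generates. When
  \<open>X\<close> consists of the singletons and \<open>T\<close> is a complex, such a relation
  forces pointlike sets into \<open>T\<close>.\<close>

definition bounding :: "'a sgrp \<Rightarrow> 'a set set \<Rightarrow> 'a set set \<Rightarrow> 'v sgrp \<Rightarrow> ('a set \<times> 'v) set \<Rightarrow> bool"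
  where "bounding S T X V R \<longleftrightarrow> R \<subseteq> carrier (power_sg S) \<times> carrier V \<and>
     (\<forall>s v s' v'. (s, v) \<in> R \<longrightarrow> (s', v') \<in> R \<longrightarrow> (s \<odot>\<^bsub>power_sg S\<^esub> s', v \<odot>\<^bsub>V\<^esub> v') \<in> R) \<and>
     (\<forall>x\<in>X. \<exists>v. (x, v) \<in> R) \<and>
     (\<forall>v\<in>carrier V. \<exists>t\<in>T. \<forall>s. (s, v) \<in> R \<longrightarrow> s \<subseteq> t)"

text \<open>Composing the relation with an injection of \<open>V\<close> into the natural numbers
  preserves all its properties, so the constructions may use whatever element type is
  convenient.\<close>

lemma bounding_transport:
  assumes H: "pseudovariety H" and V: "subgroups_embed H V" and R: "bounding S T X V R"
  obtains V' :: "nat sgrp" and R' where "V' \<in> GH H" "bounding S T X V' R'"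
proof -
  have fV: "finite_semigroup V" using V by (simp add: subgroups_embed_def)
  interpret finite_semigroup V by fact
  obtain f :: "_ \<Rightarrow> nat" where f: "inj_on f (carrier V)"
    using finite_carrier finite_imp_inj_to_nat_seg by metis
  define R' where "R' = {(s, f v) | s v. (s, v) \<in> R}"
  have RV: "R \<subseteq> carrier (power_sg S) \<times> carrier V"
    and RM: "\<And>s v s' v'. (s, v) \<in> R \<Longrightarrow> (s', v') \<in> R \<Longrightarrow> (s \<odot>\<^bsub>power_sg S\<^esub> s', v \<odot>\<^bsub>V\<^esub> v') \<in> R"
    and RX: "\<And>x. x \<in> X \<Longrightarrow> \<exists>v. (x, v) \<in> R"
    and RT: "\<And>v. v \<in> carrier V \<Longrightarrow> \<exists>t\<in>T. \<forall>s. (s, v) \<in> R \<longrightarrow> s \<subseteq> t"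
    using R by (simp_all add: bounding_def)
  have eq: "(s, f v) \<in> R' \<longleftrightarrow> (s, v) \<in> R" if "v \<in> carrier V" for s v
    using that RV f unfolding R'_def by (auto dest: inj_onD)
  have "bounding S T X (sg_transport f V) R'"
    unfolding bounding_def
  proof (intro conjI allI impI ballI)
    show "R' \<subseteq> carrier (power_sg S) \<times> carrier (sg_transport f V)"
      using RV unfolding R'_def by (auto simp del: carrier_power)
    show "\<exists>v. (x, v) \<in> R'" if "x \<in> X" for x
      using RX[OF that] unfolding R'_def by blast
    show "\<exists>t\<in>T. \<forall>s. (s, v) \<in> R' \<longrightarrow> s \<subseteq> t" if "v \<in> carrier (sg_transport f V)" for v
      using that RT eq by force
    fix s v s' v' assume "(s, v) \<in> R'" "(s', v') \<in> R'"
    then obtain u u' where u: "(s, u) \<in> R" "(s', u') \<in> R" "v = f u" "v' = f u'"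
      unfolding R'_def by blast
    then have "u \<in> carrier V" "u' \<in> carrier V" using RV by blast+
    then show "(s \<odot>\<^bsub>power_sg S\<^esub> s', v \<odot>\<^bsub>sg_transport f V\<^esub> v') \<in> R'"
      using RM[OF u(1,2)] u(3,4) f by (auto simp: R'_def)
  qed
  then show thesis using that transport_GH[OF H V f] by blast
qed


section \<open>Merging two bounding relations\<close>

text \<open>\<open>None\<close> plays the identity adjoined to \<open>V\<close>, standing for the
  empty word. The actions below multiply an element of \<open>V\<close> by one of the enlarged
  monoid, with result in \<open>V\<close> again.\<close>

definition opt_mult :: "'b sgrp \<Rightarrow> 'b option \<Rightarrow> 'b option \<Rightarrow> 'b option" where
  "opt_mult V x y = (case x of None \<Rightarrow> y
     | Some b \<Rightarrow> (case y of None \<Rightarrow> Some b | Some c \<Rightarrow> Some (b \<odot>\<^bsub>V\<^esub> c)))"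

definition left_act :: "'b sgrp \<Rightarrow> 'b option \<Rightarrow> 'b \<Rightarrow> 'b" where
  "left_act V y r = (case y of None \<Rightarrow> r | Some b \<Rightarrow> b \<odot>\<^bsub>V\<^esub> r)"

definition right_act :: "'b sgrp \<Rightarrow> 'b \<Rightarrow> 'b option \<Rightarrow> 'b" where
  "right_act V r y = (case y of None \<Rightarrow> r | Some b \<Rightarrow> r \<odot>\<^bsub>V\<^esub> b)"

definition with_one :: "'b sgrp \<Rightarrow> 'b option set" where
  "with_one V = insert None (Some ` carrier V)"

lemma opt_mult_simps [simp]:
  "opt_mult V None y = y" "opt_mult V y None = y"
  "opt_mult V (Some b) (Some c) = Some (b \<odot>\<^bsub>V\<^esub> c)"
  by (auto simp: opt_mult_def split: option.splits)

lemma None_with_one [simp]: "None \<in> with_one V"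
  and Some_with_one [simp]: "Some b \<in> with_one V \<longleftrightarrow> b \<in> carrier V"
  by (auto simp: with_one_def)

lemma act_simps [simp]:
  "left_act V None r = r" "left_act V (Some b) r = b \<odot>\<^bsub>V\<^esub> r"
  "right_act V r None = r" "right_act V r (Some b) = r \<odot>\<^bsub>V\<^esub> b"
  by (simp_all add: left_act_def right_act_def)

context finite_semigroup
begin

lemma opt_mult_closed [simp]:
  "x \<in> with_one S \<Longrightarrow> y \<in> with_one S \<Longrightarrow> opt_mult S x y \<in> with_one S"
  by (cases x; cases y) (auto simp: closed)

lemma opt_mult_assoc:
  "x \<in> with_one S \<Longrightarrow> y \<in> with_one S \<Longrightarrow> z \<in> with_one S \<Longrightarrow>
     opt_mult S (opt_mult S x y) z = opt_mult S x (opt_mult S y z)"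
  by (cases x; cases y; cases z) (auto simp: assoc)

lemma left_act_closed: "y \<in> with_one S \<Longrightarrow> r \<in> carrier S \<Longrightarrow> left_act S y r \<in> carrier S"
  by (cases y) (auto simp: closed)

lemma right_act_closed: "y \<in> with_one S \<Longrightarrow> r \<in> carrier S \<Longrightarrow> right_act S r y \<in> carrier S"
  by (cases y) (auto simp: closed)

lemma
  assumes "y \<in> with_one S" "r \<in> carrier S" "s \<in> carrier S"
  shows mult_left_act: "s \<odot> left_act S y r = left_act S (opt_mult S (Some s) y) r"
    and left_act_mult: "left_act S y r \<odot> s = left_act S y (r \<odot> s)"
    and right_act_mult: "right_act S (r \<odot> s) y = r \<odot> right_act S s y"
    and right_act_opt_mult: "right_act S r (opt_mult S (Some s) y) = r \<odot> right_act S s y"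
    and mult_left_act_right: "s \<odot> left_act S y r = right_act S s y \<odot> r"
  using assms by (cases y; simp add: assoc)+

end

lemma right_act_power_mono:
  "r \<subseteq> r' \<Longrightarrow> rel_option (\<subseteq>) y y' \<Longrightarrow> right_act (power_sg S) r y \<subseteq> right_act (power_sg S) r' y'"
  by (cases y; cases y') (auto intro: power_mult_mono[THEN subsetD])

text \<open>With \<open>a\<close> the merged letter, a word over the letters of \<open>B\<close> is recorded as \<open>Inl\<close> of its value,
  and \<open>u\<^sub>0 a u\<^sub>1 \<dots> a u\<^sub>k\<close> with \<open>k > 0\<close> as \<open>Inr (p, F)\<close>, where \<open>p\<close> is the value of \<open>u\<^sub>0\<close> (\<open>None\<close> if
  it is empty) and \<open>F z\<close> is the value of the sequence of blocks \<open>a u\<^sub>1, \<dots>, a u\<^sub>k z\<close>.\<close>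

fun merge_mult :: "'b sgrp \<Rightarrow> 'c sgrp \<Rightarrow> 'b + 'b option \<times> ('b option \<Rightarrow> 'c) \<Rightarrow>
    'b + 'b option \<times> ('b option \<Rightarrow> 'c) \<Rightarrow> 'b + 'b option \<times> ('b option \<Rightarrow> 'c)" where
  "merge_mult B C (Inl b) (Inl b') = Inl (b \<odot>\<^bsub>B\<^esub> b')"
| "merge_mult B C (Inl b) (Inr (p, F)) = Inr (opt_mult B (Some b) p, F)"
| "merge_mult B C (Inr (p, F)) (Inl b) = Inr (p, \<lambda>z\<in>with_one B. F (opt_mult B (Some b) z))"
| "merge_mult B C (Inr (p, F)) (Inr (p', F')) = Inr (p, \<lambda>z\<in>with_one B. F p' \<odot>\<^bsub>C\<^esub> F' z)"

text \<open>The functions are taken extensional on \<open>with_one B\<close>, which keeps the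
  carrier finite and lets equality be tested on \<open>with_one B\<close> alone.\<close>

definition merge :: "'b sgrp \<Rightarrow> 'c sgrp \<Rightarrow> ('b + 'b option \<times> ('b option \<Rightarrow> 'c)) sgrp" where
  "merge B C = \<lparr>carrier = Inl ` carrier B \<union> Inr ` (with_one B \<times> (with_one B \<rightarrow>\<^sub>E carrier C)),
     sg_mult = merge_mult B C\<rparr>"

lemma merge_simps [simp]:
  "Inl b \<in> carrier (merge B C) \<longleftrightarrow> b \<in> carrier B"
  "Inr q \<in> carrier (merge B C) \<longleftrightarrow> q \<in> with_one B \<times> (with_one B \<rightarrow>\<^sub>E carrier C)"
  "sg_mult (merge B C) = merge_mult B C"
  by (auto simp: merge_def)

text \<open>After separating the eight combinations of summands, associativity reduces to that of
  \<open>C\<close> and of \<open>B\<close> with an identity adjoined.\<close>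

lemma finite_semigroup_merge:
  assumes B: "finite_semigroup B" and C: "finite_semigroup C"
  shows "finite_semigroup (merge B C)"
proof -
  interpret B: finite_semigroup B by fact
  interpret C: finite_semigroup C by fact
  have bm: "b \<odot>\<^bsub>B\<^esub> b' \<in> carrier B" if "b \<in> carrier B" "b' \<in> carrier B" for b b'
    using B.closed that .
  have om: "opt_mult B (Some b) z \<in> with_one B" if "b \<in> carrier B" "z \<in> with_one B" for b z
    using that by simp
  have as: "opt_mult B (Some (b \<odot>\<^bsub>B\<^esub> b')) z = opt_mult B (Some b) (opt_mult B (Some b') z)"
    if "b \<in> carrier B" "b' \<in> carrier B" "z \<in> with_one B" for b b' z
    using B.opt_mult_assoc[of "Some b" "Some b'" z] that by simp
  have F: "F z \<in> carrier C" if "F \<in> with_one B \<rightarrow>\<^sub>E carrier C" "z \<in> with_one B" for F z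
    using that by blast
  show ?thesis
  proof
    have "finite (with_one B)" using B.finite_carrier by (simp add: with_one_def)
    then show "finite (carrier (merge B C))"
      using B.finite_carrier C.finite_carrier by (simp add: merge_def finite_PiE)
    show "carrier (merge B C) \<noteq> {}" using B.nonempty_carrier by (simp add: merge_def)
    fix x y assume xy: "x \<in> carrier (merge B C)" "y \<in> carrier (merge B C)"
    show "x \<odot>\<^bsub>merge B C\<^esub> y \<in> carrier (merge B C)"
      using xy bm om F C.closed
      by (cases "(B, C, x, y)" rule: merge_mult.cases) (simp_all add: PiE_iff)
    fix z assume z: "z \<in> carrier (merge B C)"
    show "x \<odot>\<^bsub>merge B C\<^esub> y \<odot>\<^bsub>merge B C\<^esub> z = x \<odot>\<^bsub>merge B C\<^esub> (y \<odot>\<^bsub>merge B C\<^esub> z)"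
    proof -
      consider b b' where "y = Inl b" "z = Inl b'" | b p' F' where "y = Inl b" "z = Inr (p', F')"
        | p F b' where "y = Inr (p, F)" "z = Inl b'"
        | p F p' F' where "y = Inr (p, F)" "z = Inr (p', F')"
        by (cases y; cases z) auto
      then show ?thesis
        by cases (use xy z in \<open>cases x; force simp: om as B.assoc C.assoc F B.closed
              restrict_def fun_eq_iff\<close>)+
    qed
  qed
qed

text \<open>The \<open>Inr\<close> elements form an ideal, so a subgroup with identity in
  \<open>Inl\<close> lies in the copy of \<open>B\<close>. Otherwise all its elements share the
  prefix \<open>p\<close> of the identity, and evaluating the function component at \<open>p\<close>
  embeds the subgroup into \<open>C\<close>.\<close>

lemma merge_subgroups_embed:
  assumes B: "B \<in> GH H" and C: "C \<in> GH H"
  shows "subgroups_embed H (merge B C)"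
proof (rule subgroups_embedI)
  show "finite_semigroup (merge B C)"
    using B C by (intro finite_semigroup_merge) (auto simp: GH_def)
  fix D assume D: "sg_subgroup D (merge B C)"
  obtain e where e: "D \<subseteq> carrier (merge B C)" "e \<in> D"
    "\<And>x y. x \<in> D \<Longrightarrow> y \<in> D \<Longrightarrow> merge_mult B C x y \<in> D"
    "\<And>x. x \<in> D \<Longrightarrow> merge_mult B C e x = x" "\<And>x. x \<in> D \<Longrightarrow> merge_mult B C x e = x"
    "\<And>x. x \<in> D \<Longrightarrow> \<exists>y\<in>D. merge_mult B C x y = e"
    by (rule sg_subgroupE[OF D, unfolded merge_simps(3)]) (rule that)
  show "\<exists>U\<in>GH H. \<exists>f\<in>sg_hom (restr (merge B C) D) U. inj_on f D"
  proof (cases e)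
    case (Inl b)
    have "\<exists>b. x = Inl b \<and> b \<in> carrier B" if x: "x \<in> D" for x
    proof (cases x)
      case (Inr q)
      obtain y where "merge_mult B C x y = e" using e(6) x by blast
      then show ?thesis using Inl Inr by (cases q; cases y) auto
    qed (use x e(1) in auto)
    note DB = this
    have "projl x \<in> carrier B" if "x \<in> D" for x using DB[OF that] by auto
    moreover have "projl (merge_mult B C x y) = projl x \<odot>\<^bsub>B\<^esub> projl y" if "x \<in> D" "y \<in> D" for x y
      using DB[OF that(1)] DB[OF that(2)] by auto
    ultimately have "projl \<in> sg_hom (restr (merge B C) D) B" by (simp add: sg_hom_def)
    moreover have "inj_on projl D"
      by (rule inj_onI) (metis DB sum.sel(1))
    ultimately show ?thesis using B by blast
  next
    case (Inr q)
    then obtain p E where pE: "e = Inr (p, E)" by (cases q) auto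
    have p: "p \<in> with_one B" using e(1,2) pE by auto
    have D': "\<exists>F. x = Inr (p, F) \<and> F \<in> with_one B \<rightarrow>\<^sub>E carrier C" if x: "x \<in> D" for x
    proof -
      have "merge_mult B C e x = x" "x \<in> carrier (merge B C)" using e(1,4) x by blast+
      then show ?thesis by (cases x) (auto simp: pE)
    qed
    let ?f = "\<lambda>x. snd (projr x) p"
    have "?f \<in> sg_hom (restr (merge B C) D) C"
    proof -
      have "?f x \<in> carrier C" if "x \<in> D" for x using D'[OF that] p by auto
      moreover have "?f (merge_mult B C x y) = ?f x \<odot>\<^bsub>C\<^esub> ?f y" if "x \<in> D" "y \<in> D" for x y
        using D'[OF that(1)] D'[OF that(2)] p by auto
      ultimately show ?thesis by (simp add: sg_hom_def)
    qed
    moreover have "inj_on ?f D"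
    proof (rule inj_onI)
      fix x y assume xy: "x \<in> D" "y \<in> D" "?f x = ?f y"
      \<comment> \<open>Right multiplication by \<open>e\<close> uses the function component of an
        element only through its value at \<open>p\<close>, and it fixes the elements of
        \<open>D\<close>.\<close>
      then have "merge_mult B C x e = merge_mult B C y e"
        using D'[OF xy(1)] D'[OF xy(2)] pE by auto
      then show "x = y" using e(5) xy by simp
    qed
    ultimately show ?thesis using C by blast
  qed
qed

text \<open>Words over \<open>X\<close> are controlled by \<open>R\<^sub>B\<close>. A block,
  \<open>a\<close> followed by a word related to \<open>v\<close>, is contained in the letter
  \<open>a \<odot> t v\<close> of \<open>Y\<close>, so sequences of blocks are controlled by
  \<open>R\<^sub>C\<close>. A bound for the prefix times a bound for the blocks stays in
  \<open>T\<close>.\<close>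

lemma bounding_merge:
  assumes S: "finite_semigroup S"
    and B: "finite_semigroup B" "bounding S T\<^sub>B X B R\<^sub>B" "T\<^sub>B \<subseteq> T"
    and C: "finite_semigroup C" "bounding S T\<^sub>C Y C R\<^sub>C" "T\<^sub>C \<subseteq> T"
    and T: "subsemigroup T (power_sg S)"
    and a: "a \<in> Y" "a \<in> carrier (power_sg S)"
    and t: "\<And>v s. (s, v) \<in> R\<^sub>B \<Longrightarrow> s \<subseteq> t v" "\<And>v. v \<in> carrier B \<Longrightarrow> a \<odot>\<^bsub>power_sg S\<^esub> t v \<in> Y"
  shows "\<exists>R. bounding S T (insert a X) (merge B C) R"
proof -
  let ?P = "power_sg S"
  interpret P: finite_semigroup ?P using finite_semigroup_power[OF S] .
  interpret B: finite_semigroup B by fact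
  interpret C: finite_semigroup C by fact
  have BV: "R\<^sub>B \<subseteq> carrier ?P \<times> carrier B"
    and BM: "\<And>s v s' v'. (s, v) \<in> R\<^sub>B \<Longrightarrow> (s', v') \<in> R\<^sub>B \<Longrightarrow> (s \<odot>\<^bsub>?P\<^esub> s', v \<odot>\<^bsub>B\<^esub> v') \<in> R\<^sub>B"
    and BX: "\<And>x. x \<in> X \<Longrightarrow> \<exists>v. (x, v) \<in> R\<^sub>B"
    and BT: "\<And>v. v \<in> carrier B \<Longrightarrow> \<exists>t\<in>T\<^sub>B. \<forall>s. (s, v) \<in> R\<^sub>B \<longrightarrow> s \<subseteq> t"
    using B(2) by (simp_all add: bounding_def)
  have CV: "R\<^sub>C \<subseteq> carrier ?P \<times> carrier C"
    and CM: "\<And>s v s' v'. (s, v) \<in> R\<^sub>C \<Longrightarrow> (s', v') \<in> R\<^sub>C \<Longrightarrow> (s \<odot>\<^bsub>?P\<^esub> s', v \<odot>\<^bsub>C\<^esub> v') \<in> R\<^sub>C"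
    and CY: "\<And>x. x \<in> Y \<Longrightarrow> \<exists>v. (x, v) \<in> R\<^sub>C"
    and CT: "\<And>v. v \<in> carrier C \<Longrightarrow> \<exists>t\<in>T\<^sub>C. \<forall>s. (s, v) \<in> R\<^sub>C \<longrightarrow> s \<subseteq> t"
    using C(2) by (simp_all add: bounding_def)
  \<comment> \<open>The relation \<open>R\<^sub>B\<close> extended to the empty word.\<close>
  define R1 where "R1 = insert (None, None) {(Some s, Some v) | s v. (s, v) \<in> R\<^sub>B}"
  have R1V: "y \<in> with_one ?P" "z \<in> with_one B" if "(y, z) \<in> R1" for y z
    using that BV by (auto simp: R1_def simp del: carrier_power)
  have R1M: "(opt_mult ?P (Some s) y, opt_mult B (Some v) z) \<in> R1"
    if "(s, v) \<in> R\<^sub>B" "(y, z) \<in> R1" for s v y z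
    using that BM by (auto simp: R1_def)
  \<comment> \<open>\<open>F\<close> predicts how the last block of \<open>r\<close> may be
    completed: if \<open>y\<close> is related to \<open>z\<close>, then \<open>r\<close> times
    \<open>y\<close> is contained in some element related to \<open>F z\<close>. Containment, not
    equality, is what replacing blocks by their bounds preserves.\<close>
  define acts where "acts r F \<longleftrightarrow> F \<in> with_one B \<rightarrow>\<^sub>E carrier C \<and> r \<in> carrier ?P \<and>
    (\<forall>y z. (y, z) \<in> R1 \<longrightarrow> (\<exists>s. right_act ?P r y \<subseteq> s \<and> (s, F z) \<in> R\<^sub>C))" for r F
  \<comment> \<open>In the second part \<open>y\<close> is the prefix before the first
    \<open>a\<close>, and \<open>r\<close> is the remaining sequence of blocks.\<close>
  define R where "R = {(s, Inl b) | s b. (s, b) \<in> R\<^sub>B} \<union>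
    {(left_act ?P y r, Inr (p, F)) | y r p F. (y, p) \<in> R1 \<and> acts r F}"
  \<comment> \<open>Multiplying \<open>r\<close> by \<open>s\<close> and then by \<open>y\<close>
    amounts to continuing \<open>r\<close> with \<open>s\<close> times \<open>y\<close>, which moves
    \<open>b\<close> into the argument of \<open>F\<close>.\<close>
  have acts_Inl: "acts (r \<odot>\<^bsub>?P\<^esub> s) (\<lambda>z\<in>with_one B. F (opt_mult B (Some b) z))"
    if F: "acts r F" and s: "(s, b) \<in> R\<^sub>B" for r F s b
  proof -
    have sc: "s \<in> carrier ?P" "b \<in> carrier B" using BV s by blast+
    have rc: "r \<in> carrier ?P" using F by (simp add: acts_def)
    have "\<exists>s'. right_act ?P (r \<odot>\<^bsub>?P\<^esub> s) y \<subseteq> s' \<and> (s', F (opt_mult B (Some b) z)) \<in> R\<^sub>C"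
      if yz: "(y, z) \<in> R1" for y z
    proof -
      have "right_act ?P (r \<odot>\<^bsub>?P\<^esub> s) y = right_act ?P r (opt_mult ?P (Some s) y)"
        using R1V[OF yz] sc rc by (simp only: P.right_act_mult P.right_act_opt_mult)
      then show ?thesis using F R1M[OF s yz] unfolding acts_def by metis
    qed
    moreover have "r \<odot>\<^bsub>?P\<^esub> s \<in> carrier ?P" using P.closed[OF rc sc(1)] .
    moreover have "(\<lambda>z\<in>with_one B. F (opt_mult B (Some b) z)) \<in> with_one B \<rightarrow>\<^sub>E carrier C"
      using F sc(2) by (auto simp: acts_def)
    ultimately show ?thesis unfolding acts_def using R1V by auto
  qed
  \<comment> \<open>Here \<open>y\<close> completes the last block of \<open>r\<close>, fixing the
    first factor as \<open>F p\<close>; any further continuation only affects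
    \<open>r'\<close>.\<close>
  have acts_Inr: "acts (right_act ?P r y \<odot>\<^bsub>?P\<^esub> r') (\<lambda>z\<in>with_one B. F p \<odot>\<^bsub>C\<^esub> F' z)"
    if F: "acts r F" "acts r' F'" and y: "(y, p) \<in> R1" for r F r' F' y p
  proof -
    have rc: "r \<in> carrier ?P" "r' \<in> carrier ?P" using F by (simp_all add: acts_def)
    then have rc': "right_act ?P r y \<in> carrier ?P" using P.right_act_closed R1V[OF y] by blast
    obtain s where s: "right_act ?P r y \<subseteq> s" "(s, F p) \<in> R\<^sub>C"
      using F(1) y unfolding acts_def by blast
    have "\<exists>s'. right_act ?P (right_act ?P r y \<odot>\<^bsub>?P\<^esub> r') y' \<subseteq> s' \<and> (s', F p \<odot>\<^bsub>C\<^esub> F' z) \<in> R\<^sub>C"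
      if yz: "(y', z) \<in> R1" for y' z
    proof -
      obtain s' where s': "right_act ?P r' y' \<subseteq> s'" "(s', F' z) \<in> R\<^sub>C"
        using F(2) yz unfolding acts_def by blast
      have "right_act ?P (right_act ?P r y \<odot>\<^bsub>?P\<^esub> r') y' = right_act ?P r y \<odot>\<^bsub>?P\<^esub> right_act ?P r' y'"
        using R1V[OF yz] rc' rc by (simp only: P.right_act_mult)
      also have "\<dots> \<subseteq> s \<odot>\<^bsub>?P\<^esub> s'" using s(1) s'(1) by (rule power_mult_mono)
      finally show ?thesis using CM[OF s(2) s'(2)] by blast
    qed
    moreover have "right_act ?P r y \<odot>\<^bsub>?P\<^esub> r' \<in> carrier ?P" using P.closed[OF rc' rc(2)] .
    moreover have "(\<lambda>z\<in>with_one B. F p \<odot>\<^bsub>C\<^esub> F' z) \<in> with_one B \<rightarrow>\<^sub>E carrier C"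
      using F R1V(2)[OF y] C.closed by (auto simp: acts_def)
    ultimately show ?thesis unfolding acts_def using R1V by auto
  qed
  have R_Inl: "(s, Inl b) \<in> R \<longleftrightarrow> (s, b) \<in> R\<^sub>B" for s b by (auto simp: R_def)
  have R_Inr: "(s, Inr (p, F)) \<in> R \<longleftrightarrow> (\<exists>y r. s = left_act ?P y r \<and> (y, p) \<in> R1 \<and> acts r F)"
    for s p F by (auto simp: R_def)
  have "bounding S T (insert a X) (merge B C) R"
    unfolding bounding_def
  proof (intro conjI allI impI ballI)
    show "R \<subseteq> carrier ?P \<times> carrier (merge B C)"
    proof (rule subrelI)
      fix s v assume "(s, v) \<in> R"
      then show "(s, v) \<in> carrier ?P \<times> carrier (merge B C)"
        using BV R1V P.left_act_closed
        by (cases v) (auto simp: R_Inl R_Inr acts_def simp del: carrier_power)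
    qed
  next
    fix s v s' v' assume sv: "(s, v) \<in> R" "(s', v') \<in> R"
    consider b b' where "v = Inl b" "v' = Inl b'"
      | b p' F' where "v = Inl b" "v' = Inr (p', F')"
      | p F b' where "v = Inr (p, F)" "v' = Inl b'"
      | p F p' F' where "v = Inr (p, F)" "v' = Inr (p', F')"
      by (cases v; cases v') auto
    then show "(s \<odot>\<^bsub>?P\<^esub> s', v \<odot>\<^bsub>merge B C\<^esub> v') \<in> R"
    proof cases
      case 1
      then show ?thesis using sv BM by (simp add: R_Inl)
    next
      case 2
      then obtain y r where *: "(s, b) \<in> R\<^sub>B" "s' = left_act ?P y r" "(y, p') \<in> R1" "acts r F'"
        using sv by (auto simp: R_Inl R_Inr)
      have "s \<in> carrier ?P" "r \<in> carrier ?P" using BV *(1,4) by (auto simp only: acts_def)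
      then have "s \<odot>\<^bsub>?P\<^esub> s' = left_act ?P (opt_mult ?P (Some s) y) r"
        using P.mult_left_act[OF R1V(1)[OF *(3)]] unfolding *(2) by blast
      then show ?thesis using 2 R1M[OF *(1,3)] *(4) by (auto simp: R_Inr)
    next
      case 3
      then obtain y r where *: "(s', b') \<in> R\<^sub>B" "s = left_act ?P y r" "(y, p) \<in> R1" "acts r F"
        using sv by (auto simp: R_Inl R_Inr)
      have "s' \<in> carrier ?P" "r \<in> carrier ?P" using BV *(1,4) by (auto simp only: acts_def)
      then have "s \<odot>\<^bsub>?P\<^esub> s' = left_act ?P y (r \<odot>\<^bsub>?P\<^esub> s')"
        using P.left_act_mult[OF R1V(1)[OF *(3)]] unfolding *(2) by blast
      then show ?thesis using 3 *(3) acts_Inl[OF *(4,1)] by (auto simp: R_Inr)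
    next
      case 4
      then obtain y r y' r' where *: "s = left_act ?P y r" "(y, p) \<in> R1" "acts r F"
        "s' = left_act ?P y' r'" "(y', p') \<in> R1" "acts r' F'"
        using sv by (auto simp: R_Inr)
      have rc: "r \<in> carrier ?P" "r' \<in> carrier ?P" using * by (simp_all add: acts_def)
      have "s \<odot>\<^bsub>?P\<^esub> s' = left_act ?P y (r \<odot>\<^bsub>?P\<^esub> left_act ?P y' r')"
        unfolding * using P.left_act_mult P.left_act_closed R1V[OF *(2)] R1V[OF *(5)] rc by blast
      also have "r \<odot>\<^bsub>?P\<^esub> left_act ?P y' r' = right_act ?P r y' \<odot>\<^bsub>?P\<^esub> r'"
        using P.mult_left_act_right R1V[OF *(5)] rc by blast
      finally show ?thesis using 4 *(2) acts_Inr[OF *(3,6,5)] by (auto simp: R_Inr)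
    qed
  next
    fix x assume x: "x \<in> insert a X"
    show "\<exists>v. (x, v) \<in> R"
    proof (cases "x \<in> X")
      case True
      then show ?thesis using BX R_Inl by blast
    next
      case False
      then have x: "x = a" using x by blast
      \<comment> \<open>\<open>u z\<close> is a letter of \<open>Y\<close> containing
        \<open>a\<close> times every word related to \<open>z\<close>; at \<open>None\<close> it is
        \<open>a\<close> itself.\<close>
      define u where "u z = right_act ?P a (map_option t z)" for z
      have "\<exists>v. (u z, v) \<in> R\<^sub>C" if "z \<in> with_one B" for z
        using that CY a(1) t(2) by (cases z) (auto simp: u_def)
      then obtain F where F: "\<And>z. z \<in> with_one B \<Longrightarrow> (u z, F z) \<in> R\<^sub>C" by metis
      have "acts a (restrict F (with_one B))"
        unfolding acts_def
      proof (intro conjI allI impI a(2))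
        show "restrict F (with_one B) \<in> with_one B \<rightarrow>\<^sub>E carrier C"
        proof (rule restrict_PiE_iff[THEN iffD2], rule ballI)
          fix z assume "z \<in> with_one B"
          then have "(u z, F z) \<in> carrier ?P \<times> carrier C" using F CV by (rule_tac subsetD)
          then show "F z \<in> carrier C" by simp
        qed
        fix y z assume yz: "(y, z) \<in> R1"
        then have "rel_option (\<subseteq>) y (map_option t z)" using t(1) by (auto simp: R1_def)
        then have "right_act ?P a y \<subseteq> u z" unfolding u_def by (intro right_act_power_mono) auto
        then show "\<exists>s. right_act ?P a y \<subseteq> s \<and> (s, restrict F (with_one B) z) \<in> R\<^sub>C"
          using F[OF R1V(2)[OF yz]] R1V(2)[OF yz] by (metis restrict_apply')
      qed
      moreover have "(None, None) \<in> R1" by (simp add: R1_def)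
      ultimately have "(a, Inr (None, restrict F (with_one B))) \<in> R"
        unfolding R_Inr by (metis act_simps(1))
      then show ?thesis using x by blast
    qed
  next
    fix v assume v: "v \<in> carrier (merge B C)"
    show "\<exists>t\<in>T. \<forall>s. (s, v) \<in> R \<longrightarrow> s \<subseteq> t"
    proof (cases v)
      case (Inl b)
      then have "b \<in> carrier B" using v by simp
      then obtain t where "t \<in> T\<^sub>B" "\<forall>s. (s, b) \<in> R\<^sub>B \<longrightarrow> s \<subseteq> t" using BT by blast
      then show ?thesis using B(3) unfolding Inl R_Inl by blast
    next
      case (Inr q)
      then obtain p F where pF: "v = Inr (p, F)" by (cases q) auto
      then have "F None \<in> carrier C" using v by auto
      then obtain t' where t': "t' \<in> T" "\<And>s. (s, F None) \<in> R\<^sub>C \<Longrightarrow> s \<subseteq> t'"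
        using CT C(3) by blast
      \<comment> \<open>Continuing by the empty word leaves \<open>r\<close> unchanged, so
        \<open>r\<close> is contained in an element of the fibre over \<open>F None\<close>.\<close>
      have rt: "r \<subseteq> t'" if r: "acts r F" for r
      proof -
        have "\<exists>s. right_act ?P r None \<subseteq> s \<and> (s, F None) \<in> R\<^sub>C"
          using r unfolding acts_def by (elim conjE allE[of _ None] impE) (simp_all add: R1_def)
        then obtain s where "r \<subseteq> s" "(s, F None) \<in> R\<^sub>C" by auto
        then show ?thesis using t'(2)[of s] by simp
      qed
      show ?thesis
      proof (cases p)
        case None
        then have "\<forall>s. (s, v) \<in> R \<longrightarrow> s \<subseteq> t'" using rt by (auto simp: pF R_Inr R1_def)
        then show ?thesis using t'(1) by blast
      next
        case (Some b)
        then have "b \<in> carrier B" using v pF by auto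
        then obtain t0 where t0: "t0 \<in> T" "\<And>s. (s, b) \<in> R\<^sub>B \<Longrightarrow> s \<subseteq> t0"
          using BT B(3) by blast
        have "s \<subseteq> t0 \<odot>\<^bsub>?P\<^esub> t'" if s: "(s, v) \<in> R" for s
        proof -
          obtain y r where "s = y \<odot>\<^bsub>?P\<^esub> r" "(y, b) \<in> R\<^sub>B" "acts r F"
            using s Some by (auto simp: pF R_Inr R1_def)
          then show ?thesis using power_mult_mono[OF t0(2) rt] by blast
        qed
        moreover have "t0 \<odot>\<^bsub>?P\<^esub> t' \<in> T"
          using T t0(1) t'(1) by (simp add: subsemigroup_def)
        ultimately show ?thesis by blast
      qed
    qed
  qed
  then show ?thesis ..
qed


section \<open>The base cases of the induction\<close>

text \<open>A subgroup projects to a single point of \<open>Z\<close>, so its projection to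
  \<open>Q\<close> is injective.\<close>

lemma pair_subgroups_embed:
  assumes H: "pseudovariety H" and Q: "Q \<in> H" and Z: "finite_semigroup Z"
    and ap: "\<And>D. sg_subgroup D Z \<Longrightarrow> \<exists>z. D \<subseteq> {z}"
  shows "subgroups_embed H (sg_pair Q Z)"
proof (rule subgroups_embedI)
  show fs: "finite_semigroup (sg_pair Q Z)"
    using finite_semigroup_pair[OF pseudovariety_semigroup[OF H Q] Z] .
  fix D assume D: "sg_subgroup D (sg_pair Q Z)"
  then have sub: "D \<subseteq> carrier Q \<times> carrier Z"
    by (simp add: sg_subgroup_def subsemigroup_def sg_pair_def)
  have "fst \<in> sg_hom (restr (sg_pair Q Z) D) Q" "snd \<in> sg_hom (restr (sg_pair Q Z) D) Z"
    using sub by (auto simp: sg_hom_def sg_pair_def split_beta)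
  moreover from this(2) obtain z where "snd ` D \<subseteq> {z}"
    using ap sg_subgroup_image[OF Z D] by blast
  then have "snd x = z" if "x \<in> D" for x using that by blast
  then have "inj_on fst D" by (intro inj_onI prod_eqI) simp_all
  ultimately show "\<exists>U\<in>GH H. \<exists>f\<in>sg_hom (restr (sg_pair Q Z) D) U. inj_on f D"
    using H_subset_GH[OF H] Q by blast
qed

text \<open>One relation on \<open>G\<close> has only pointlike non-empty fibres, and saturation
  puts their unions into \<open>T\<close>.\<close>

lemma saturated_fibres:
  assumes H: "pseudovariety H" and S: "finite_semigroup S" and T: "saturated H S T"
    and G: "G \<subseteq> T" "sg_subgroup G (power_sg S)"
  obtains Q R where "Q \<in> H" "relational_morphism (restr (power_sg S) G) Q R"
    "\<And>g v. (g, v) \<in> R \<Longrightarrow> \<Union>{g. (g, v) \<in> R} \<in> T"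
proof -
  have "finite_semigroup (restr (power_sg S) G)"
    using G(2) finite_semigroup_restr[OF finite_semigroup_power[OF S]] by (simp add: sg_subgroup_def)
  from fibres_pointlike[OF H this] obtain Q R where
    QR: "Q \<in> H" "relational_morphism (restr (power_sg S) G) Q R"
    "\<And>v. {g. (g, v) \<in> R} \<noteq> {} \<Longrightarrow> {g. (g, v) \<in> R} \<in> PL H (restr (power_sg S) G)" by metis
  have "\<Union>{g. (g, v) \<in> R} \<in> T" if "(g, v) \<in> R" for g v
  proof -
    have "{g. (g, v) \<in> R} \<in> PL H (restr (power_sg S) G)" using that by (intro QR(3)) blast
    then show ?thesis using T G unfolding saturated_def by simp
  qed
  then show thesis using that QR(1,2) by blast
qed

text \<open>The elements permuting \<open>T\<close> from the left form a right group \<open>L\<close>; the second component of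
  \<open>V\<close> remembers the last letter, i.e. its right zero coordinate.\<close>

lemma bounding_right_group:
  fixes S :: "'a sgrp"
  assumes H: "pseudovariety H" and S: "finite_semigroup S" and T: "saturated H S T"
    and X: "X \<subseteq> T" "X \<noteq> {}" and perm: "\<And>x. x \<in> X \<Longrightarrow> (\<lambda>t. x \<odot>\<^bsub>power_sg S\<^esub> t) ` T = T"
  obtains V :: "(nat \<times> 'a set) sgrp" and R where "subgroups_embed H V" "bounding S T X V R"
proof -
  let ?P = "power_sg S"
  interpret P: finite_semigroup ?P using finite_semigroup_power[OF S] .
  have sT: "subsemigroup T ?P" using T by (simp add: saturated_def)
  have Tc: "T \<subseteq> carrier ?P" using sT by (simp add: subsemigroup_def)
  have TT: "x \<odot>\<^bsub>?P\<^esub> y \<in> T" if "x \<in> T" "y \<in> T" for x y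
    using sT that by (simp add: subsemigroup_def)
  have as: "x \<odot>\<^bsub>?P\<^esub> y \<odot>\<^bsub>?P\<^esub> z = x \<odot>\<^bsub>?P\<^esub> (y \<odot>\<^bsub>?P\<^esub> z)" if "x \<in> T" "y \<in> T" "z \<in> T" for x y z
    using P.assoc that Tc by blast
  have fT: "finite T" using P.finite_carrier Tc finite_subset by blast
  define L where "L = {g \<in> T. (\<lambda>t. g \<odot>\<^bsub>?P\<^esub> t) ` T = T}"
  have LT: "g \<in> T" if "g \<in> L" for g using that by (simp add: L_def)
  have XL: "x \<in> L" if "x \<in> X" for x using that X perm by (auto simp: L_def)
  have im: "(\<lambda>t. g \<odot>\<^bsub>?P\<^esub> h \<odot>\<^bsub>?P\<^esub> t) ` T = (\<lambda>t. g \<odot>\<^bsub>?P\<^esub> t) ` (\<lambda>t. h \<odot>\<^bsub>?P\<^esub> t) ` T"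
    if "g \<in> T" "h \<in> T" for g h
    unfolding image_image using as[OF that] by (intro image_cong) auto
  have LL: "g \<odot>\<^bsub>?P\<^esub> h \<in> L" if "g \<in> L" "h \<in> L" for g h
    using im[of g h] that TT by (simp add: L_def)
  have "subsemigroup L ?P"
    using LL XL X(2) Tc LT by (auto simp only: subsemigroup_def)
  then obtain e where e: "e \<in> L" "e \<odot>\<^bsub>?P\<^esub> e = e" using P.subsemigroup_idempotent by blast
  have eT: "e \<in> T" using LT e(1) .
  \<comment> \<open>The idempotent \<open>e\<close> satisfies eT = T, hence is a left identity of
    \<open>T\<close>.\<close>
  have el: "e \<odot>\<^bsub>?P\<^esub> t = t" if t: "t \<in> T" for t
  proof -
    have "t \<in> (\<lambda>t. e \<odot>\<^bsub>?P\<^esub> t) ` T" using e(1) t by (simp add: L_def)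
    then obtain u where "u \<in> T" "t = e \<odot>\<^bsub>?P\<^esub> u" by blast
    then show ?thesis using as[of e e u] eT e(2) by simp
  qed
  \<comment> \<open>This is Le, the subgroup of \<open>L\<close> with identity
    \<open>e\<close>.\<close>
  define G where "G = {g \<in> L. g \<odot>\<^bsub>?P\<^esub> e = g}"
  have GT: "g \<in> T" if "g \<in> G" for g using that LT by (simp add: G_def)
  have Ge: "g \<odot>\<^bsub>?P\<^esub> e = g" if "g \<in> G" for g using that by (simp add: G_def)
  have GL: "g \<in> L" if "g \<in> G" for g using that by (simp add: G_def)
  have eG: "e \<in> G" using e by (simp add: G_def)
  have LG: "g \<odot>\<^bsub>?P\<^esub> h \<in> G" if "g \<in> L" "h \<in> G" for g h
    using that LL as[of g h e] LT eT by (simp add: G_def)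
  have inv: "\<exists>z\<in>G. g \<odot>\<^bsub>?P\<^esub> z = e" if g: "g \<in> G" for g
  proof -
    have "e \<in> (\<lambda>t. g \<odot>\<^bsub>?P\<^esub> t) ` T" using GL[OF g] eT by (simp add: L_def)
    then obtain u where u: "u \<in> T" "g \<odot>\<^bsub>?P\<^esub> u = e" by blast
    let ?uT = "(\<lambda>t. u \<odot>\<^bsub>?P\<^esub> t) ` T"
    have "(\<lambda>t. g \<odot>\<^bsub>?P\<^esub> t) ` ?uT = T" using im[of g u] GT[OF g] u e(1) by (simp add: L_def)
    \<comment> \<open>Since guT = eT = T, the set uT has at least as many elements as
      \<open>T\<close>; hence the solution \<open>u\<close> of gu = e permutes \<open>T\<close> as
      well.\<close>
    then have "card T \<le> card ?uT" using card_image_le[of ?uT "\<lambda>t. g \<odot>\<^bsub>?P\<^esub> t"] fT by simp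
    moreover have "?uT \<subseteq> T" using TT u(1) by auto
    ultimately have "?uT = T" using fT card_seteq by blast
    then have "u \<in> L" using u by (simp add: L_def)
    then have "u \<odot>\<^bsub>?P\<^esub> e \<in> G" using LG eG by blast
    moreover have "g \<odot>\<^bsub>?P\<^esub> (u \<odot>\<^bsub>?P\<^esub> e) = e" using as[of g u e] GT[OF g] u eT e(2) by simp
    ultimately show ?thesis by blast
  qed
  have "sg_subgroup G ?P"
  proof (rule sg_subgroupI[OF finite_semigroup_power[OF S] _ eG])
    show "G \<subseteq> carrier ?P" using GT Tc by blast
    fix x assume x: "x \<in> G"
    show "x \<odot>\<^bsub>?P\<^esub> y \<in> G" if "y \<in> G" for y using LG[OF GL[OF x] that] .
    show "e \<odot>\<^bsub>?P\<^esub> x = x" using el[OF GT[OF x]] .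
    show "x \<odot>\<^bsub>?P\<^esub> e = x" using Ge[OF x] .
    show "\<exists>y\<in>G. x \<odot>\<^bsub>?P\<^esub> y = e" using inv[OF x] .
  qed
  moreover have "G \<subseteq> T" using GT by blast
  ultimately obtain Q RQ where Q: "Q \<in> H" "relational_morphism (restr ?P G) Q RQ"
    "\<And>g v. (g, v) \<in> RQ \<Longrightarrow> \<Union>{g. (g, v) \<in> RQ} \<in> T"
    using saturated_fibres[OF H S T] by metis
  \<comment> \<open>The right zero semigroup on \<open>X\<close>; an identity \<open>z\<close> in a
    subgroup forces x = xz = z there.\<close>
  define Z where "Z = \<lparr>carrier = X, sg_mult = (\<lambda>x y :: 'a set. y)\<rparr>"
  have fZ: "finite_semigroup Z"
    using X fT by unfold_locales (auto simp: Z_def intro: finite_subset)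
  have "\<exists>z. D \<subseteq> {z}" if D: "sg_subgroup D Z" for D
  proof -
    obtain z where "\<And>x. x \<in> D \<Longrightarrow> x \<odot>\<^bsub>Z\<^esub> z = x" by (rule sg_subgroupE[OF D]) (rule that)
    then show ?thesis by (auto simp: Z_def)
  qed
  then have emb: "subgroups_embed H (sg_pair Q Z)"
    by (rule pair_subgroups_embed[OF H Q(1) fZ])
  \<comment> \<open>A product hc with \<open>h\<close> in \<open>G\<close> and last letter
    \<open>c\<close> is pushed into \<open>G\<close> by \<open>e\<close>, giving the group
    coordinate, while \<open>c\<close> is remembered in \<open>Z\<close>.\<close>
  define R where "R = {(h \<odot>\<^bsub>?P\<^esub> c, (v, c)) | h c v. h \<in> G \<and> c \<in> X \<and> (h \<odot>\<^bsub>?P\<^esub> c \<odot>\<^bsub>?P\<^esub> e, v) \<in> RQ}"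
  have RI: "(h \<odot>\<^bsub>?P\<^esub> c, (v, c)) \<in> R" if "h \<in> G" "c \<in> X" "(h \<odot>\<^bsub>?P\<^esub> c \<odot>\<^bsub>?P\<^esub> e, v) \<in> RQ" for h c v
    using that unfolding R_def by blast
  have "bounding S T X (sg_pair Q Z) R"
    unfolding bounding_def
  proof (intro conjI allI impI ballI)
    show "R \<subseteq> carrier ?P \<times> carrier (sg_pair Q Z)"
    proof
      fix p assume "p \<in> R"
      then obtain h c v where p: "p = (h \<odot>\<^bsub>?P\<^esub> c, (v, c))" "h \<in> G" "c \<in> X"
        "(h \<odot>\<^bsub>?P\<^esub> c \<odot>\<^bsub>?P\<^esub> e, v) \<in> RQ" unfolding R_def by blast
      have "h \<odot>\<^bsub>?P\<^esub> c \<in> carrier ?P" using TT[OF GT[OF p(2)]] p(3) X Tc by blast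
      moreover have "v \<in> carrier Q" using pairE[OF Q(2) p(4)] by blast
      ultimately show "p \<in> carrier ?P \<times> carrier (sg_pair Q Z)"
        using p(1,3) by (simp add: sg_pair_def Z_def)
    qed
  next
    fix s v s' v' assume "(s, v) \<in> R" "(s', v') \<in> R"
    then obtain h c w h' c' w' where *: "s = h \<odot>\<^bsub>?P\<^esub> c" "v = (w, c)" "h \<in> G" "c \<in> X"
      "(s \<odot>\<^bsub>?P\<^esub> e, w) \<in> RQ" "s' = h' \<odot>\<^bsub>?P\<^esub> c'" "v' = (w', c')" "h' \<in> G" "c' \<in> X"
      "(s' \<odot>\<^bsub>?P\<^esub> e, w') \<in> RQ" unfolding R_def by blast
    have mem: "h \<in> T" "c \<in> T" "h' \<in> T" "c' \<in> T" "s \<in> T" "s' \<in> T"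
      using * GT X TT by auto
    \<comment> \<open>The product again has the required form: its last letter is \<open>c'\<close>,
      and the factor before it lies in \<open>G\<close>.\<close>
    have "s \<odot>\<^bsub>?P\<^esub> s' = (s \<odot>\<^bsub>?P\<^esub> h') \<odot>\<^bsub>?P\<^esub> c'"
      using mem as *(6) by simp
    moreover have "s \<odot>\<^bsub>?P\<^esub> h' \<in> G" using LG LL GL XL * by metis
    moreover have "(s \<odot>\<^bsub>?P\<^esub> e) \<odot>\<^bsub>?P\<^esub> (s' \<odot>\<^bsub>?P\<^esub> e) = (s \<odot>\<^bsub>?P\<^esub> s') \<odot>\<^bsub>?P\<^esub> e"
      using mem as[of s e "s' \<odot>\<^bsub>?P\<^esub> e"] as[of e s' e] as[of s s' e] el[of s'] eT TT by simp
    then have "((s \<odot>\<^bsub>?P\<^esub> s') \<odot>\<^bsub>?P\<^esub> e, w \<odot>\<^bsub>Q\<^esub> w') \<in> RQ"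
      using relational_morphism_mult[OF Q(2) *(5,10)] by simp
    moreover have "v \<odot>\<^bsub>sg_pair Q Z\<^esub> v' = (w \<odot>\<^bsub>Q\<^esub> w', c')"
      using * by (simp add: sg_pair_def Z_def)
    ultimately show "(s \<odot>\<^bsub>?P\<^esub> s', v \<odot>\<^bsub>sg_pair Q Z\<^esub> v') \<in> R"
      using RI *(9) by metis
  next
    fix x assume x: "x \<in> X"
    then have "e \<odot>\<^bsub>?P\<^esub> x = x" using el X by blast
    moreover have "x \<odot>\<^bsub>?P\<^esub> e \<in> G" using LG XL x eG by blast
    then obtain v where "(x \<odot>\<^bsub>?P\<^esub> e, v) \<in> RQ"
      using relational_morphism_total[OF Q(2)] by auto
    ultimately show "\<exists>v. (x, v) \<in> R" using RI[OF eG x] by auto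
  next
    fix v assume v: "v \<in> carrier (sg_pair Q Z)"
    then obtain w c where wc: "v = (w, c)" "c \<in> X" by (auto simp: sg_pair_def Z_def)
    have cT: "c \<in> T" using wc X by blast
    show "\<exists>t\<in>T. \<forall>s. (s, v) \<in> R \<longrightarrow> s \<subseteq> t"
    proof (cases "\<exists>g. (g, w) \<in> RQ")
      case False
      then have "\<forall>s. (s, v) \<notin> R" by (auto simp: R_def wc)
      then show ?thesis using cT by blast
    next
      case True
      let ?U = "\<Union>{g. (g, w) \<in> RQ}"
      have U: "?U \<in> T" using True Q(3) by blast
      obtain i where i: "i \<in> G" "(c \<odot>\<^bsub>?P\<^esub> e) \<odot>\<^bsub>?P\<^esub> i = e"
        using inv LG XL[OF wc(2)] eG by blast
      have "s \<subseteq> ?U \<odot>\<^bsub>?P\<^esub> (i \<odot>\<^bsub>?P\<^esub> c)" if s: "(s, v) \<in> R" for s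
      proof -
        obtain h where h: "h \<in> G" "s = h \<odot>\<^bsub>?P\<^esub> c" "(s \<odot>\<^bsub>?P\<^esub> e, w) \<in> RQ"
          using s by (auto simp: R_def wc)
        have mem: "h \<in> T" "i \<in> T" "c \<odot>\<^bsub>?P\<^esub> e \<in> T" "i \<odot>\<^bsub>?P\<^esub> c \<in> T"
          using h i GT TT cT eT by auto
        \<comment> \<open>As \<open>e\<close> is a left identity, c = ec = (ce)(ic). Thus
          \<open>s\<close> is recovered from its group part \<open>s \<odot> e\<close>, which lies
          in the fibre over \<open>w\<close>, by a factor depending on \<open>c\<close>
          only.\<close>
        have "s = h \<odot>\<^bsub>?P\<^esub> ((c \<odot>\<^bsub>?P\<^esub> e) \<odot>\<^bsub>?P\<^esub> (i \<odot>\<^bsub>?P\<^esub> c))"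
          using h(2) i(2) as[of "c \<odot>\<^bsub>?P\<^esub> e" i c] mem cT el by simp
        also have "\<dots> = (s \<odot>\<^bsub>?P\<^esub> e) \<odot>\<^bsub>?P\<^esub> (i \<odot>\<^bsub>?P\<^esub> c)"
          using h(2) as[of h c e] as[of h "c \<odot>\<^bsub>?P\<^esub> e" "i \<odot>\<^bsub>?P\<^esub> c"] mem cT eT by simp
        also have "\<dots> \<subseteq> ?U \<odot>\<^bsub>?P\<^esub> (i \<odot>\<^bsub>?P\<^esub> c)"
          using h(3) by (intro power_mult_mono) auto
        finally show ?thesis .
      qed
      moreover have "?U \<odot>\<^bsub>?P\<^esub> (i \<odot>\<^bsub>?P\<^esub> c) \<in> T" using TT U GT i cT by blast
      ultimately show ?thesis by blast
    qed
  qed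
  then show thesis using that emb by blast
qed

text \<open>\<open>sg_pow V a k\<close> is the power \<open>a\<^sup>k\<^sup>+\<^sup>1\<close>.\<close>

primrec sg_pow :: "'b sgrp \<Rightarrow> 'b \<Rightarrow> nat \<Rightarrow> 'b" where
  "sg_pow V a 0 = a"
| "sg_pow V a (Suc k) = sg_pow V a k \<odot>\<^bsub>V\<^esub> a"

context finite_semigroup
begin

lemma sg_pow_closed: "subsemigroup A S \<Longrightarrow> a \<in> A \<Longrightarrow> sg_pow S a k \<in> A"
  by (induction k) (auto simp: subsemigroup_def)

lemma subsemigroup_carrier: "subsemigroup (carrier S) S"
  using nonempty_carrier closed by (simp add: subsemigroup_def)

text \<open>Indices are one less than exponents, so adding the exponents raises the sum of the
  indices by one.\<close>

lemma sg_pow_add: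
  assumes a: "a \<in> carrier S"
  shows "sg_pow S a i \<odot> sg_pow S a j = sg_pow S a (Suc (i + j))"
proof (induction j)
  case (Suc j)
  have c: "sg_pow S a k \<in> carrier S" for k using sg_pow_closed[OF subsemigroup_carrier a] .
  have "sg_pow S a i \<odot> sg_pow S a (Suc j) = (sg_pow S a i \<odot> sg_pow S a j) \<odot> a"
    using assoc[OF c c a] by simp
  then show ?case using Suc by simp
qed simp

end

text \<open>The powers of \<open>a\<close> from an idempotent one on form a cyclic group, handled by
  a member of \<open>H\<close>. A counter truncated at the exponent of that idempotent distinguishes
  the finitely many earlier powers.\<close>

lemma bounding_monogenic:
  assumes H: "pseudovariety H" and S: "finite_semigroup S" and T: "saturated H S T"
    and a: "a \<in> T"
  obtains V :: "(nat \<times> nat) sgrp" and R where "subgroups_embed H V" "bounding S T {a} V R"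
proof -
  let ?P = "power_sg S" and ?p = "sg_pow (power_sg S) a"
  interpret P: finite_semigroup ?P using finite_semigroup_power[OF S] .
  have sT: "subsemigroup T ?P" using T by (simp add: saturated_def)
  have Tc: "T \<subseteq> carrier ?P" using sT by (simp add: subsemigroup_def)
  have ac: "a \<in> carrier ?P" using a Tc by blast
  have pT: "?p k \<in> T" for k using P.sg_pow_closed[OF sT a] .
  note add = P.sg_pow_add[OF ac]
  have "subsemigroup (range ?p) ?P"
    unfolding subsemigroup_def using pT Tc by (auto simp only: add image_iff)
  then obtain m where "?p m \<odot>\<^bsub>?P\<^esub> ?p m = ?p m"
    using P.subsemigroup_idempotent by (metis imageE)
  \<comment> \<open>The idempotent is the power with exponent m + 1; its square has exponent 2m + 2,
    which is index 2m + 1.\<close>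
  then have idem: "?p (Suc (m + m)) = ?p m" by (simp only: add)
  have period: "?p (j * Suc m + m) = ?p m" for j
  proof (induction j)
    case (Suc j)
    have "?p (Suc j * Suc m + m) = ?p (j * Suc m + m) \<odot>\<^bsub>?P\<^esub> ?p m"
      unfolding add by (simp add: algebra_simps)
    then show ?case using Suc idem by (simp only: add)
  qed simp
  have absorb: "?p (Suc (m + k)) = ?p k" if "m \<le> k" for k
  proof (cases "k = m")
    case False
    then obtain r where k: "k = Suc (m + r)" using \<open>m \<le> k\<close> less_imp_Suc_add[of m k] by auto
    have "?p (Suc (m + k)) = ?p (Suc (m + m)) \<odot>\<^bsub>?P\<^esub> ?p r" unfolding add k by (simp add: algebra_simps)
    then show ?thesis unfolding idem add k .
  qed (use idem in simp)
  define G where "G = {?p k | k. m \<le> k}"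
  have GI: "?p k \<in> G" if "m \<le> k" for k using that by (auto simp: G_def)
  have "sg_subgroup G ?P"
  proof (rule sg_subgroupI[OF finite_semigroup_power[OF S], where e = "?p m"])
    show "G \<subseteq> carrier ?P" using pT Tc by (auto simp only: G_def)
    show "?p m \<in> G" by (rule GI) simp
    fix x assume "x \<in> G"
    then obtain k where k: "x = ?p k" "m \<le> k" by (auto simp: G_def)
    show "?p m \<odot>\<^bsub>?P\<^esub> x = x" unfolding k(1) add using absorb[OF k(2)] .
    show "x \<odot>\<^bsub>?P\<^esub> ?p m = x" unfolding k(1) add using absorb[OF k(2)] by (simp add: add.commute)
    \<comment> \<open>The inverse is chosen so that the exponents add up to (k + 2)(m + 1), a
      multiple of the exponent of the idempotent.\<close>
    have "Suc (k + (m + k * m + m)) = Suc k * Suc m + m" by (simp add: algebra_simps)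
    then have "x \<odot>\<^bsub>?P\<^esub> ?p (m + k * m + m) = ?p m"
      unfolding k(1) add using period[of "Suc k"] by (simp only:)
    then show "\<exists>y\<in>G. x \<odot>\<^bsub>?P\<^esub> y = ?p m" by (intro bexI[OF _ GI]) auto
  next
    fix x y assume "x \<in> G" "y \<in> G"
    then obtain k l where "x = ?p k" "y = ?p l" "m \<le> k" by (auto simp: G_def)
    then show "x \<odot>\<^bsub>?P\<^esub> y \<in> G" unfolding \<open>x = _\<close> \<open>y = _\<close> add by (intro GI) simp
  qed
  moreover have "G \<subseteq> T" using pT by (auto simp: G_def)
  ultimately obtain Q RQ where Q: "Q \<in> H" "relational_morphism (restr ?P G) Q RQ"
    "\<And>g v. (g, v) \<in> RQ \<Longrightarrow> \<Union>{g. (g, v) \<in> RQ} \<in> T"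
    using saturated_fibres[OF H S T] by metis
  \<comment> \<open>Addition of positive integers truncated at m + 1; its only idempotent is m + 1,
    and adding a positive number fixes nothing else.\<close>
  define Z where "Z = \<lparr>carrier = {1..Suc m}, sg_mult = (\<lambda>i j. min (i + j) (Suc m))\<rparr>"
  have fZ: "finite_semigroup Z"
    by unfold_locales (auto simp: Z_def)
  have "\<exists>z. D \<subseteq> {z}" if D: "sg_subgroup D Z" for D
  proof -
    obtain z where z: "D \<subseteq> carrier Z" "z \<in> D" "\<And>x. x \<in> D \<Longrightarrow> x \<odot>\<^bsub>Z\<^esub> z = x"
      by (rule sg_subgroupE[OF D]) (rule that)
    have "z \<ge> 1" using z(1,2) by (auto simp: Z_def)
    then have "x = Suc m" if "x \<in> D" for x
      using z(3)[OF that] by (simp add: Z_def)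
    then show ?thesis by blast
  qed
  then have emb: "subgroups_embed H (sg_pair Q Z)"
    by (rule pair_subgroups_embed[OF H Q(1) fZ])
  \<comment> \<open>Multiplication by the idempotent moves every power of \<open>a\<close> into
    \<open>G\<close>, where \<open>RQ\<close> supplies the group coordinate.\<close>
  define R where "R = {(?p k, (v, min (Suc k) (Suc m))) | k v. (?p (Suc (m + k)), v) \<in> RQ}"
  have RI: "(?p k, (v, min (Suc k) (Suc m))) \<in> R" if "(?p (Suc (m + k)), v) \<in> RQ" for k v
    using that unfolding R_def by blast
  have "bounding S T {a} (sg_pair Q Z) R"
    unfolding bounding_def
  proof (intro conjI allI impI ballI)
    show "R \<subseteq> carrier ?P \<times> carrier (sg_pair Q Z)"
    proof
      fix x assume "x \<in> R"
      then obtain k v where "x = (?p k, (v, min (Suc k) (Suc m)))" "(?p (Suc (m + k)), v) \<in> RQ"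
        unfolding R_def by blast
      moreover have "?p k \<in> carrier ?P" using pT Tc by blast
      ultimately show "x \<in> carrier ?P \<times> carrier (sg_pair Q Z)"
        using pairE[OF Q(2)] by (simp add: sg_pair_def Z_def)
    qed
  next
    fix s v s' v' assume "(s, v) \<in> R" "(s', v') \<in> R"
    then obtain k w k' w' where *: "s = ?p k" "v = (w, min (Suc k) (Suc m))"
      "(?p (Suc (m + k)), w) \<in> RQ" "s' = ?p k'" "v' = (w', min (Suc k') (Suc m))"
      "(?p (Suc (m + k')), w') \<in> RQ" unfolding R_def by blast
    have "?p (Suc (m + k)) \<odot>\<^bsub>?P\<^esub> ?p (Suc (m + k')) = ?p (Suc (m + m)) \<odot>\<^bsub>?P\<^esub> ?p (Suc (k + k'))"
      unfolding add by (simp add: algebra_simps)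
    then have "?p (Suc (m + k)) \<odot>\<^bsub>?P\<^esub> ?p (Suc (m + k')) = ?p (Suc (m + Suc (k + k')))"
      unfolding idem by (simp only: add)
    then have "(?p (Suc (m + Suc (k + k'))), w \<odot>\<^bsub>Q\<^esub> w') \<in> RQ"
      using relational_morphism_mult[OF Q(2) *(3,6)] by simp
    then have "(?p (Suc (k + k')), (w \<odot>\<^bsub>Q\<^esub> w', min (Suc (Suc (k + k'))) (Suc m))) \<in> R"
      by (rule RI)
    moreover have "v \<odot>\<^bsub>sg_pair Q Z\<^esub> v' = (w \<odot>\<^bsub>Q\<^esub> w', min (Suc (Suc (k + k'))) (Suc m))"
      by (simp add: *(2,5) sg_pair_def Z_def)
    ultimately show "(s \<odot>\<^bsub>?P\<^esub> s', v \<odot>\<^bsub>sg_pair Q Z\<^esub> v') \<in> R"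
      unfolding *(1,4) add by simp
  next
    fix x assume "x \<in> {a}"
    moreover have "?p (Suc (m + 0)) \<in> G" by (rule GI) simp
    then obtain v where "(?p (Suc (m + 0)), v) \<in> RQ"
      using relational_morphism_total[OF Q(2)] by (metis restr_simps(1))
    ultimately show "\<exists>v. (x, v) \<in> R" using RI[of 0 v] by auto
  next
    fix v assume "v \<in> carrier (sg_pair Q Z)"
    then obtain w i where v: "v = (w, i)" "1 \<le> i" "i \<le> Suc m" by (auto simp: sg_pair_def Z_def)
    show "\<exists>t\<in>T. \<forall>s. (s, v) \<in> R \<longrightarrow> s \<subseteq> t"
    \<comment> \<open>A full counter means that \<open>s\<close> already lies in \<open>G\<close>
      and is not changed by the idempotent, so the fibre of \<open>RQ\<close> bounds it. A smaller
      counter determines \<open>s\<close>; if the fibre of \<open>RQ\<close> is empty, any element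
      of \<open>T\<close> will do.\<close>
    proof (cases "i = Suc m \<and> (\<exists>g. (g, w) \<in> RQ)")
      case True
      have "s \<subseteq> \<Union>{g. (g, w) \<in> RQ}" if "(s, v) \<in> R" for s
      proof -
        obtain k where "s = ?p k" "min (Suc k) (Suc m) = Suc m" "(?p (Suc (m + k)), w) \<in> RQ"
          using \<open>(s, v) \<in> R\<close> True v(1) unfolding R_def by auto
        then show ?thesis using absorb[of k] by auto
      qed
      then show ?thesis using Q(3) True by blast
    next
      case False
      have "s \<subseteq> ?p (i - 1)" if "(s, v) \<in> R" for s
      proof -
        obtain k where k: "s = ?p k" "min (Suc k) (Suc m) = i" "(?p (Suc (m + k)), w) \<in> RQ"
          using \<open>(s, v) \<in> R\<close> v(1) unfolding R_def by auto
        then have "i \<noteq> Suc m" using False by blast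
        then have "k = i - 1" using k(2) by simp
        then show ?thesis using k(1) by simp
      qed
      then show ?thesis using pT by blast
    qed
  qed
  then show thesis using that emb by blast
qed


section \<open>The induction\<close>

text \<open>For a subgroup of the right ideal with identity \<open>e\<close>, the union U of a
  pointlike subset lies in \<open>T\<close> and satisfies eU = U; as \<open>e\<close> is in the
  ideal, so is U.\<close>

lemma saturated_right_ideal:
  assumes S: "finite_semigroup S" and T: "saturated H S T" and a: "a \<in> T"
  shows "saturated H S (insert a ((\<lambda>t. a \<odot>\<^bsub>power_sg S\<^esub> t) ` T))" (is "saturated H S ?I")
proof -
  let ?P = "power_sg S"
  interpret P: finite_semigroup ?P using finite_semigroup_power[OF S] .
  have sT: "subsemigroup T ?P" using T by (simp add: saturated_def)
  have Tc: "T \<subseteq> carrier ?P" using sT by (simp add: subsemigroup_def)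
  have TT: "x \<odot>\<^bsub>?P\<^esub> y \<in> T" if "x \<in> T" "y \<in> T" for x y
    using sT that by (simp add: subsemigroup_def)
  have as: "x \<odot>\<^bsub>?P\<^esub> y \<odot>\<^bsub>?P\<^esub> z = x \<odot>\<^bsub>?P\<^esub> (y \<odot>\<^bsub>?P\<^esub> z)" if "x \<in> T" "y \<in> T" "z \<in> T" for x y z
    using P.assoc that Tc by blast
  have IT: "?I \<subseteq> T" using TT a by auto
  have right: "x \<odot>\<^bsub>?P\<^esub> y \<in> ?I" if x: "x \<in> ?I" and y: "y \<in> T" for x y
  proof -
    consider "x = a" | t where "x = a \<odot>\<^bsub>?P\<^esub> t" "t \<in> T" using x by blast
    then show ?thesis
    proof cases
      case 2
      then have "x \<odot>\<^bsub>?P\<^esub> y = a \<odot>\<^bsub>?P\<^esub> (t \<odot>\<^bsub>?P\<^esub> y)" using as a y by simp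
      then show ?thesis using TT[OF 2(2) y] by blast
    qed (use y in blast)
  qed
  have "subsemigroup ?I ?P"
    unfolding subsemigroup_def
  proof (intro conjI ballI)
    show "?I \<subseteq> carrier ?P" using IT Tc by (rule order_trans)
    show "x \<odot>\<^bsub>?P\<^esub> y \<in> ?I" if "x \<in> ?I" "y \<in> ?I" for x y
      by (rule right[OF that(1)]) (rule subsetD[OF IT that(2)])
  qed simp
  moreover have un: "\<Union>\<X> \<in> ?I" if G: "G \<subseteq> ?I" "sg_subgroup G ?P" and X: "\<X> \<in> PL H (restr ?P G)" for G \<X>
  proof -
    obtain e where e: "e \<in> G" "\<And>x. x \<in> G \<Longrightarrow> e \<odot>\<^bsub>?P\<^esub> x = x"
      by (rule sg_subgroupE[OF G(2)]) (rule that)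
    have "G \<subseteq> T" using G(1) IT by (rule order_trans)
    then have "\<Union>\<X> \<in> T" using T G(2) X unfolding saturated_def by simp
    moreover have "\<X> \<subseteq> G" using X by (simp add: PL_def)
    then have "e \<odot>\<^bsub>?P\<^esub> \<Union>\<X> = \<Union>\<X>"
      unfolding power_mult_Union using e(2) by (auto simp: subset_iff)
    moreover have "e \<in> ?I" using e(1) G(1) by (rule rev_subsetD)
    ultimately show ?thesis using right by metis
  qed
  ultimately show ?thesis
    unfolding saturated_def by (intro conjI allI impI ballI un) simp_all
qed

text \<open>A second letter \<open>b\<close> would give b in aT and a in bT, hence a in aT, and then
  aT = T.\<close>

lemma singleton_of_nonpermuting:
  assumes S: "finite_semigroup S" and T: "subsemigroup T S" and X: "X \<subseteq> T"
    and gen: "\<And>x. x \<in> X \<Longrightarrow> insert x ((\<lambda>t. x \<odot>\<^bsub>S\<^esub> t) ` T) = T"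
    and a: "a \<in> X" "(\<lambda>t. a \<odot>\<^bsub>S\<^esub> t) ` T \<noteq> T"
  shows "X = {a}"
proof -
  interpret finite_semigroup S by fact
  have "b = a" if b: "b \<in> X" for b
  proof (rule ccontr)
    assume "b \<noteq> a"
    moreover have "b \<in> T" "a \<in> T" using a b X by auto
    ultimately have "b \<in> (\<lambda>t. a \<odot>\<^bsub>S\<^esub> t) ` T" "a \<in> (\<lambda>t. b \<odot>\<^bsub>S\<^esub> t) ` T"
      using gen[OF a(1)] gen[OF b] by auto
    then obtain t u where tu: "t \<in> T" "u \<in> T" "b = a \<odot>\<^bsub>S\<^esub> t" "a = b \<odot>\<^bsub>S\<^esub> u" by blast
    then have "a = a \<odot>\<^bsub>S\<^esub> (t \<odot>\<^bsub>S\<^esub> u)"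
      using assoc[of a t u] T \<open>a \<in> T\<close> by (metis subsemigroup_def subsetD)
    moreover have "t \<odot>\<^bsub>S\<^esub> u \<in> T" using T tu by (simp add: subsemigroup_def)
    ultimately have "a \<in> (\<lambda>t. a \<odot>\<^bsub>S\<^esub> t) ` T" by (rule image_eqI)
    then show False using gen[OF a(1)] a(2) by (simp add: insert_absorb)
  qed
  then show ?thesis using a(1) by blast
qed

text \<open>The outer induction is on the size of \<open>T\<close>, for all \<open>X\<close> at
  once; the inner one removes a letter from \<open>X\<close> with \<open>T\<close> fixed.\<close>

lemma exists_bounding:
  assumes H: "pseudovariety H" and S: "finite_semigroup S"
    and "saturated H S T" "X \<subseteq> T"
  shows "\<exists>V\<in>GH H. \<exists>R. bounding S T X V R"
  using assms(3,4)
proof (induction "card T" arbitrary: T X rule: less_induct)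
  case (less T)
  let ?P = "power_sg S"
  have sT: "subsemigroup T ?P" using less.prems by (simp add: saturated_def)
  have Tc: "T \<subseteq> carrier ?P" "T \<noteq> {}" using sT by (simp_all add: subsemigroup_def)
  have fT: "finite T"
    using finite_semigroup.finite_carrier[OF finite_semigroup_power[OF S]] Tc finite_subset by blast
  have "finite X" using less.prems(2) fT finite_subset by blast
  then show ?case using less.prems(2)
  proof (induction X rule: finite_psubset_induct)
    case (psubset X)
    let ?I = "\<lambda>a. (\<lambda>t. a \<odot>\<^bsub>?P\<^esub> t) ` T"
    consider "X = {}" | a where "a \<in> X" "insert a (?I a) \<noteq> T"
      | "X \<noteq> {}" "\<And>a. a \<in> X \<Longrightarrow> ?I a = T"
      | a where "\<And>x. x \<in> X \<Longrightarrow> insert x (?I x) = T" "a \<in> X" "?I a \<noteq> T" by metis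
    then show ?case
    proof cases
      case 1
      \<comment> \<open>Only some member of \<open>H\<close> is wanted here; the empty relation is
        bounded because \<open>T\<close> is non-empty.\<close>
      obtain Q where "Q \<in> H" using fibres_pointlike[OF H S] by metis
      then have "Q \<in> GH H" using H_subset_GH[OF H] by blast
      moreover have "bounding S T X Q {}" using 1 Tc(2) by (auto simp: bounding_def)
      ultimately show ?thesis by blast
    next
      case 2
      have aT: "a \<in> T" using 2(1) psubset.prems by blast
      have sat: "saturated H S (insert a (?I a))"
        using saturated_right_ideal[OF S less.prems(1) aT] .
      have sub: "insert a (?I a) \<subseteq> T" using sT aT by (auto simp: subsemigroup_def)
      have "X - {a} \<subset> X" "X - {a} \<subseteq> T" using 2(1) psubset.prems by blast+
      then obtain B R\<^sub>B where B: "B \<in> GH H" "bounding S T (X - {a}) B R\<^sub>B"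
        using psubset.IH by meson
      have BV: "R\<^sub>B \<subseteq> carrier ?P \<times> carrier B"
        and "\<forall>v\<in>carrier B. \<exists>t\<in>T. \<forall>s. (s, v) \<in> R\<^sub>B \<longrightarrow> s \<subseteq> t"
        using B(2) by (simp_all add: bounding_def)
      then obtain t where t: "\<And>v. v \<in> carrier B \<Longrightarrow> t v \<in> T"
        "\<And>v s. v \<in> carrier B \<Longrightarrow> (s, v) \<in> R\<^sub>B \<Longrightarrow> s \<subseteq> t v" by metis
      \<comment> \<open>These letters bound the blocks beginning with \<open>a\<close> and all lie
        in the strictly smaller right ideal, so the outer induction applies to them.\<close>
      define Y where "Y = insert a ((\<lambda>v. a \<odot>\<^bsub>?P\<^esub> t v) ` carrier B)"
      have "card (insert a (?I a)) < card T"
        using sub 2(2) fT by (intro psubset_card_mono) auto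
      moreover have "Y \<subseteq> insert a (?I a)" using t(1) by (auto simp only: Y_def)
      ultimately obtain C R\<^sub>C where C: "C \<in> GH H" "bounding S (insert a (?I a)) Y C R\<^sub>C"
        using less.hyps[OF _ sat] by meson
      have "\<exists>R. bounding S T (insert a (X - {a})) (merge B C) R"
      proof (rule bounding_merge[OF S _ B(2) order_refl _ C(2) sub sT])
        show "finite_semigroup B" "finite_semigroup C" using B(1) C(1) by (simp_all add: GH_def)
        show "a \<in> Y" by (simp add: Y_def)
        show "a \<in> carrier ?P" using aT Tc by blast
        show "s \<subseteq> t v" if "(s, v) \<in> R\<^sub>B" for v s
        proof -
          have "v \<in> carrier B" using that BV by blast
          then show ?thesis using t(2) that by blast
        qed
        show "a \<odot>\<^bsub>?P\<^esub> t v \<in> Y" if "v \<in> carrier B" for v using that unfolding Y_def by blast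
      qed
      then obtain R where "bounding S T X (merge B C) R" using 2(1) by (auto simp: insert_absorb)
      then show ?thesis
        using bounding_transport[OF H merge_subgroups_embed[OF B(1) C(1)]] by metis
    next
      case 3
      then obtain V :: "(nat \<times> 'a set) sgrp" and R
        where "subgroups_embed H V" "bounding S T X V R"
        using bounding_right_group[OF H S less.prems(1) psubset.prems] by metis
      then show ?thesis using bounding_transport[OF H] by metis
    next
      case 4
      then have "X = {a}"
        using singleton_of_nonpermuting[OF finite_semigroup_power[OF S] sT psubset.prems] by blast
      moreover have "a \<in> T" using 4(2) psubset.prems by blast
      ultimately obtain V :: "(nat \<times> nat) sgrp" and R
        where "subgroups_embed H V" "bounding S T X V R"
        using bounding_monogenic[OF H S less.prems(1)] by metis
      then show ?thesis using bounding_transport[OF H] by metis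
    qed
  qed
qed

section \<open>Both inclusions\<close>

theorem mainTheorem1:
  fixes H :: "nat sgrp set" and S :: "'a sgrp"
  assumes "group_pseudovariety H"
    and "finite_semigroup S"
  shows "C_GH H S = PL (GH H) S"
proof
  have H: "pseudovariety H" using assms(1) by (simp add: group_pseudovariety_def)
  interpret finite_semigroup S by fact
  let ?P = "power_sg S"
  have sat: "saturated H S K \<longleftrightarrow> (\<forall>G. sg_subgroup G (restr ?P K) \<longrightarrow>
      (\<forall>\<X>\<in>PL H (restr ?P G). \<Union>\<X> \<in> K))" if "is_complex S K" for K
  proof -
    have "subsemigroup K ?P" using that by (simp add: is_complex_def)
    then show ?thesis unfolding saturated_def by (simp add: sg_subgroup_restr_iff)
  qed
  have C: "C_GH H S = \<Inter>{K. is_complex S K \<and> saturated H S K}"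
    unfolding C_GH_def using sat by (metis (no_types, lifting))
  \<comment> \<open>The pointlike sets are themselves one of the complexes being
    intersected.\<close>
  show "C_GH H S \<subseteq> PL (GH H) S"
    unfolding C using is_complex_PL saturated_PL_GH assms(2) by blast
  show "PL (GH H) S \<subseteq> C_GH H S"
    unfolding C
  proof (intro subsetI InterI)
    fix X K assume X: "X \<in> PL (GH H) S" and "K \<in> {K. is_complex S K \<and> saturated H S K}"
    then have K: "is_complex S K" "saturated H S K" by simp_all
    have "(\<lambda>s. {s}) ` carrier S \<subseteq> K" using K(1) by (auto simp: is_complex_def)
    then obtain V R where V: "V \<in> GH H" "bounding S K ((\<lambda>s. {s}) ` carrier S) V R"
      using exists_bounding[OF H assms(2) K(2)] by blast
    then have RV: "R \<subseteq> carrier ?P \<times> carrier V"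
      and RM: "\<And>s v s' v'. (s, v) \<in> R \<Longrightarrow> (s', v') \<in> R \<Longrightarrow> (s \<odot>\<^bsub>?P\<^esub> s', v \<odot>\<^bsub>V\<^esub> v') \<in> R"
      and RX: "\<And>s. s \<in> carrier S \<Longrightarrow> \<exists>v. ({s}, v) \<in> R"
      and RT: "\<And>v. v \<in> carrier V \<Longrightarrow> \<exists>t\<in>K. \<forall>s. (s, v) \<in> R \<longrightarrow> s \<subseteq> t"
      by (simp_all add: bounding_def)
    \<comment> \<open>Singletons multiply like the elements of \<open>S\<close>, so restricting the
      bounding relation to them yields a relational morphism from \<open>S\<close> to
      \<open>V\<close>.\<close>
    define R' where "R' = {(s, v). ({s}, v) \<in> R}"
    have "relational_morphism S V R'"
      unfolding relational_morphism_def subsemigroup_def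
    proof (intro conjI ballI)
      show "R' \<noteq> {}" using RX nonempty_carrier by (auto simp: R'_def)
      show "R' \<subseteq> carrier (sg_pair S V)" using RV by (auto simp: R'_def sg_pair_def)
      show "fst ` R' = carrier S"
      proof
        show "fst ` R' \<subseteq> carrier S" using RV by (auto simp: R'_def)
        show "carrier S \<subseteq> fst ` R'"
        proof
          fix s assume "s \<in> carrier S"
          then obtain v where "(s, v) \<in> R'" using RX by (auto simp: R'_def)
          then show "s \<in> fst ` R'" by (rule image_eqI[rotated]) simp
        qed
      qed
      fix p q assume "p \<in> R'" "q \<in> R'"
      then obtain s v s' v' where pq: "p = (s, v)" "q = (s', v')" "({s}, v) \<in> R" "({s'}, v') \<in> R"
        by (auto simp: R'_def)
      then have "({s} \<odot>\<^bsub>?P\<^esub> {s'}, v \<odot>\<^bsub>V\<^esub> v') \<in> R" using RM by blast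
      then show "p \<odot>\<^bsub>sg_pair S V\<^esub> q \<in> R'"
        using pq(1,2) by (simp add: R'_def sg_pair_def power_mult)
    qed
    then obtain v where v: "v \<in> carrier V" "X \<subseteq> {s. (s, v) \<in> R'}"
      using X V(1) unfolding PL_def by blast
    obtain t where t: "t \<in> K" "\<And>s. (s, v) \<in> R \<Longrightarrow> s \<subseteq> t" using RT[OF v(1)] by blast
    \<comment> \<open>The pointlike set lies in one fibre, hence below a member of \<open>K\<close>,
      and complexes are closed under non-empty subsets.\<close>
    have "X \<subseteq> t"
    proof
      fix s assume "s \<in> X"
      then have "({s}, v) \<in> R" using v(2) by (auto simp: R'_def)
      then show "s \<in> t" using t(2) by blast
    qed
    moreover have "X \<noteq> {}" using X by (simp add: PL_def)
    ultimately show "X \<in> K" using K(1) t(1) unfolding is_complex_def by blast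
  qed
qed

end
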